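(* Let $\mathbb{T}$ be a time scale, let $a,b\in\mathbb{T}$ with $b>a$, let $n\in\mathbb{N}$, let $p_i\in C_{rd}(\mathbb{T},\mathbb{R})$ for $i=1,2,\dots,n$, and let $\Gamma$ be the resolvent kernel of the kernel $$K(t,s)=\sum_{i=0}^{n-1}p_{n-i}(t)\,h_{n-i-1}(t,\sigma(s)),\qquad (t,s)\in\Omega(a,b).$$ For $\lambda\in\mathbb{R}$ and $s\in\mathbb{T}^{\kappa^{n-1}}$, let $y(\lambda;\cdot,s)$ denote the unique solution of the initial value problem $$y^{\Delta^{n}}(t)-\lambda\sum_{i=0}^{n-1}p_{n-i}(t)y^{\Delta^{i}}(t)=0\ \text{ for } t\in\mathbb{T}^{\kappa^{n}},\qquad y^{\Delta^{i}}(\sigma(s))=\delta_{i,n-1}\ \text{ for } i=0,1,\dots,n-1,$$ where $\delta$ is the Kronecker delta. Then for $\lambda\neq0$, $$\Gamma(\lambda;t,s)=\frac{1}{\lambda}\,y^{\Delta^{n}}(\lambda;t,s)$$ for all $t\in\mathbb{T}^{\kappa^{n}}$ and $s\in\mathbb{T}^{\kappa^{n-1}}$ with $(t,s)\in\Omega(a,b)$, where $y^{\Delta^{n}}(\lambda;t,s)$ is the $n$-th $\Delta$-derivative of $y(\lambda;\cdot,s)$ at $t$.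
   Context: A time scale $\mathbb{T}$ is a nonempty closed subset of $\mathbb{R}$ with the topology inherited from $\mathbb{R}$; a subscript $\mathbb{T}$ on an interval denotes its intersection with $\mathbb{T}$. For $t\in\mathbb{T}$, $\sigma(t):=\inf(t,\infty)_{\mathbb{T}}$, $\rho(t):=\sup(-\infty,t)_{\mathbb{T}}$ and $\mu(t):=\sigma(t)-t$ (with $\inf\emptyset=\sup\mathbb{T}$, $\sup\emptyset=\inf\mathbb{T}$). A point $t$ is right-dense if $\sigma(t)=t$ and left-dense if $\rho(t)=t$. $\mathbb{T}^{\kappa}:=\mathbb{T}\setminus\{\sup\mathbb{T}\}$ if $\sup\mathbb{T}=\max\mathbb{T}$ and $\rho(\max\mathbb{T})\ne\max\mathbb{T}$, and $\mathbb{T}^{\kappa}:=\mathbb{T}$ otherwise; $\mathbb{T}^{\kappa^0}:=\mathbb{T}$, $\mathbb{T}^{\kappa^{n}}:=(\mathbb{T}^{\kappa^{n-1}})^{\kappa}$. A function is rd-continuous if it is continuous at right-dense points and has finite (left-sided) limits at left-dense points; $C_{rd}(\mathbb{T},\mathbb{R})$ denotes the set of rd-continuous functions $\mathbb{T}\to\mathbb{R}$. The $\Delta$-derivative $g^{\Delta}(t)$ is the number $\ell$ such that for every $\varepsilon>0$ there is a neighborhood $U$ of $t$ with $|[g(\sigma(t))-g(r)]-\ell[\sigma(t)-r]|\le\varepsilon|\sigma(t)-r|$ for all $r\in U$; $g^{\Delta^0}:=g$, $g^{\Delta^{i}}:=(g^{\Delta^{i-1}})^{\Delta}$. The $\Delta$-integral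 is $\int_s^t g(\eta)\,\Delta\eta=G(t)-G(s)$, where $G$ is a $\Delta$-antiderivative of $g$, i.e. $G^{\Delta}=g$ (in particular $\int_t^s=-\int_s^t$ and $\int_{\sigma(s)}^{s}g(\eta)\,\Delta\eta=-\mu(s)g(s)$). The generalized monomials $h_k:\mathbb{T}\times\mathbb{T}\to\mathbb{R}$ are $h_0(t,s):=1$ and $h_k(t,s):=\int_s^t h_{k-1}(\eta,s)\,\Delta\eta$ for $k\in\mathbb{N}=\{1,2,\dots\}$. $\Omega(a,b):=\{(t,s)\in\mathbb{T}\times\mathbb{T}:\ b\ge t\ge s\ge a\}$. The iterated kernels of $K$ are defined for $(t,s)\in\Omega(a,b)$ by $K_0(t,s):=K(t,s)$ and $K_m(t,s):=\int_{\sigma(s)}^{t}K(t,\eta)K_{m-1}(\eta,s)\,\Delta\eta$ for $m\in\mathbb{N}$. The resolvent kernel of $K$ is $\Gamma(\lambda;t,s):=\sum_{\ell=0}^{\infty}K_{\ell}(t,s)\lambda^{\ell}$ for $(t,s)\in\Omega(a,b)$ and $\lambda\in\mathbb{R}$.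
   Formalization: Convergence of the series for Γ(λ;t,s) is assumed when t < σ(s) (t = s right-scattered), where it can diverge (T=ℤ, n=1, p₁=1, λ=2), and proved otherwise; a solution y is taken as given, with σ(s) in T^{κ^{n-1}} so that the initial conditions are defined. *)

theory Defs
  imports Complex_Main
begin

definition time_scale :: "real set \<Rightarrow> bool" where
  "time_scale T \<longleftrightarrow> T \<noteq> {} \<and> closed T"

definition fwd_jump :: "real set \<Rightarrow> real \<Rightarrow> real" where
  "fwd_jump T t = (if T \<inter> {t<..} = {} then Sup T else Inf (T \<inter> {t<..}))"

definition bwd_jump :: "real set \<Rightarrow> real \<Rightarrow> real" where
  "bwd_jump T t = (if T \<inter> {..<t} = {} then Inf T else Sup (T \<inter> {..<t}))"

definition right_dense :: "real set \<Rightarrow> real \<Rightarrow> bool" where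
  "right_dense T t \<longleftrightarrow> fwd_jump T t = t"

definition left_dense :: "real set \<Rightarrow> real \<Rightarrow> bool" where
  "left_dense T t \<longleftrightarrow> bwd_jump T t = t"

definition kappa :: "real set \<Rightarrow> real set" where
  "kappa T = (if bdd_above T \<and> Sup T \<in> T \<and> bwd_jump T (Sup T) \<noteq> Sup T
              then T - {Sup T} else T)"

definition kappa_pow :: "real set \<Rightarrow> nat \<Rightarrow> real set" where
  "kappa_pow T n = (kappa ^^ n) T"

definition rd_continuous :: "real set \<Rightarrow> (real \<Rightarrow> real) \<Rightarrow> bool" where
  "rd_continuous T f \<longleftrightarrow>
     (\<forall>t\<in>T. right_dense T t \<longrightarrow> continuous (at t within T) f) \<and>
     (\<forall>t\<in>T. left_dense T t \<longrightarrow> (\<exists>L. (f \<longlongrightarrow> L) (at t within (T \<inter> {..<t}))))"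

definition has_delta_derivative :: "real set \<Rightarrow> (real \<Rightarrow> real) \<Rightarrow> real \<Rightarrow> real \<Rightarrow> bool" where
  "has_delta_derivative T g l t \<longleftrightarrow>
     (\<forall>\<epsilon>>0. \<exists>\<delta>>0. \<forall>r\<in>T. \<bar>r - t\<bar> < \<delta> \<longrightarrow>
        \<bar>(g (fwd_jump T t) - g r) - l * (fwd_jump T t - r)\<bar> \<le> \<epsilon> * \<bar>fwd_jump T t - r\<bar>)"

definition delta_deriv :: "real set \<Rightarrow> (real \<Rightarrow> real) \<Rightarrow> real \<Rightarrow> real" where
  "delta_deriv T g t = (THE l. has_delta_derivative T g l t)"

text \<open>The \<open>i\<close>-th derivative lives on the time scale \<open>kappa_pow T i\<close>; the next derivative is
  therefore taken relative to that time scale, at the points of \<open>kappa_pow T (Suc i)\<close>.\<close>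

primrec delta_deriv_n :: "real set \<Rightarrow> nat \<Rightarrow> (real \<Rightarrow> real) \<Rightarrow> real \<Rightarrow> real" where
  "delta_deriv_n T 0 g = g"
| "delta_deriv_n T (Suc i) g = delta_deriv (kappa_pow T i) (delta_deriv_n T i g)"

definition delta_differentiable_n :: "real set \<Rightarrow> nat \<Rightarrow> (real \<Rightarrow> real) \<Rightarrow> bool" where
  "delta_differentiable_n T n g \<longleftrightarrow>
     (\<forall>i<n. \<forall>t\<in>kappa_pow T (Suc i).
        \<exists>l. has_delta_derivative (kappa_pow T i) (delta_deriv_n T i g) l t)"

definition delta_antiderivative :: "real set \<Rightarrow> (real \<Rightarrow> real) \<Rightarrow> (real \<Rightarrow> real) \<Rightarrow> bool" where
  "delta_antiderivative T g G \<longleftrightarrow> (\<forall>t\<in>kappa T. has_delta_derivative T G (g t) t)"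

definition delta_integral :: "real set \<Rightarrow> (real \<Rightarrow> real) \<Rightarrow> real \<Rightarrow> real \<Rightarrow> real" where
  "delta_integral T g s t = (let G = (SOME G. delta_antiderivative T g G) in G t - G s)"

primrec gen_monomial :: "real set \<Rightarrow> nat \<Rightarrow> real \<Rightarrow> real \<Rightarrow> real" where
  "gen_monomial T 0 = (\<lambda>t s. 1)"
| "gen_monomial T (Suc k) = (\<lambda>t s. delta_integral T (\<lambda>\<eta>. gen_monomial T k \<eta> s) s t)"

definition Omega :: "real set \<Rightarrow> real \<Rightarrow> real \<Rightarrow> (real \<times> real) set" where
  "Omega T a b = {(t, s). t \<in> T \<and> s \<in> T \<and> b \<ge> t \<and> t \<ge> s \<and> s \<ge> a}"

text \<open>Kernels are total functions. On \<open>Omega T a b\<close> the iterated kernels depend only on the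
  values of \<open>K\<close> on \<open>Omega T a b\<close>, as long as the antiderivatives involved exist on all of
  \<open>T\<close>.\<close>

primrec iterated_kernel ::
  "real set \<Rightarrow> (real \<Rightarrow> real \<Rightarrow> real) \<Rightarrow> nat \<Rightarrow> real \<Rightarrow> real \<Rightarrow> real" where
  "iterated_kernel T K 0 = K"
| "iterated_kernel T K (Suc m) =
     (\<lambda>t s. delta_integral T (\<lambda>\<eta>. K t \<eta> * iterated_kernel T K m \<eta> s) (fwd_jump T s) t)"

definition resolvent_kernel ::
  "real set \<Rightarrow> (real \<Rightarrow> real \<Rightarrow> real) \<Rightarrow> real \<Rightarrow> real \<Rightarrow> real \<Rightarrow> real" where
  "resolvent_kernel T K lam t s = (\<Sum>l. iterated_kernel T K l t s * lam ^ l)"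

text \<open>The condition \<open>fwd_jump T s \<in> kappa_pow T (n - 1)\<close> says that the initial conditions are
  meaningful: \<open>kappa_pow T (n - 1)\<close> is the domain of the derivative of order \<open>n - 1\<close>, and it
  is contained in the domains of the derivatives of lower order.\<close>

definition ivp_solution ::
  "real set \<Rightarrow> nat \<Rightarrow> (nat \<Rightarrow> real \<Rightarrow> real) \<Rightarrow> real \<Rightarrow> real \<Rightarrow> (real \<Rightarrow> real) \<Rightarrow> bool" where
  "ivp_solution T n p lam s y \<longleftrightarrow>
     delta_differentiable_n T n y \<and>
     (\<forall>t\<in>kappa_pow T n.
        delta_deriv_n T n y t - lam * (\<Sum>i = 0..n-1. p (n - i) t * delta_deriv_n T i y t) = 0) \<and>
     fwd_jump T s \<in> kappa_pow T (n - 1) \<and>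
     (\<forall>i\<in>{0..n-1}. delta_deriv_n T i y (fwd_jump T s) = (if i = n - 1 then 1 else 0))"

end

theory Submission
  imports Defs "HOL-Analysis.Analysis"
begin

text \<open>
  Let \<open>c = \<sigma>(s)\<close> be the point where the initial values are prescribed, and let \<open>\<phi> = y\<^sup>\<Delta>\<^sup>n / \<lambda>\<close>.

  For \<open>t \<ge> c\<close> the proof turns the initial value problem into a Volterra equation. Taylor's formula
  (\<open>delta_taylor_unit_impulse\<close>) writes \<open>y\<^sup>\<Delta>\<^sup>i\<close> as \<open>h\<^sub>n\<^sub>-\<^sub>i\<^sub>-\<^sub>1(\<cdot>,c)\<close> plus the \<open>(n-i)\<close>-fold integral of \<open>\<lambda> \<phi>\<close>. The
  \<open>(k+1)\<close>-fold integral of a function is its integral against \<open>h\<^sub>k(t,\<sigma>(\<eta>))\<close>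
  (\<open>gen_monomial_second_argument\<close>). Inserting this into the differential equation gives
  \<open>\<phi>(t) = K(t,s) + \<lambda> \<integral>\<^sub>c\<^sup>t K(t,\<eta>) \<phi>(\<eta>) \<Delta>\<eta>\<close>. Substituting the equation into itself produces the partial
  sums of the resolvent, with a remainder that is a high power of the integral operator applied to
  \<open>\<phi>\<close>. In a norm with an exponential weight, \<open>\<lambda>\<close> times this operator halves the size of functions, so
  the remainder tends to zero (\<open>neumann_series_sums\<close>). This gives convergence of the series and its
  value at once.

  If \<open>t < c\<close>, then \<open>t = s\<close> is right-scattered. All integrals from \<open>c\<close> to \<open>s\<close> collapse to one gap, the
  resolvent is a geometric series, and the differential equation at \<open>s\<close> is a linear equation for the
  same number (\<open>resolvent_sums_before_jump\<close>).

  The calculus behind this rests on two facts about a general time scale. Rd-continuous functions have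
  antiderivatives (\<open>rd_continuous_has_antiderivative\<close>), namely the ordinary integrals of their extensions
  that are constant on gaps. Inequalities between derivatives can be integrated
  (\<open>delta_derivative_comparison\<close>), by an induction along the time scale; this gives uniqueness of the
  integral and the estimates. The higher derivatives of \<open>y\<close> live on smaller and smaller sets, but to
  the left of \<open>t\<close> these sets agree with \<open>T\<close>, so that only continuity needs to be known at \<open>t\<close> itself.
\<close>

section \<open>Jump operators and truncated time scales\<close>

lemma fwd_jump_ge:
  assumes "t \<in> T" shows "t \<le> fwd_jump T t"
proof (cases "T \<inter> {t<..} = {}")
  case True
  then have "Sup T = t" using assms by (intro cSup_eq_maximum) force+
  then show ?thesis using True by (simp add: fwd_jump_def)
next
  case False
  then have "t \<le> Inf (T \<inter> {t<..})" by (intro cInf_greatest) auto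
  then show ?thesis using False by (simp add: fwd_jump_def)
qed

lemma fwd_jump_le:
  assumes "r \<in> T" "t < r" shows "fwd_jump T t \<le> r"
proof -
  have "Inf (T \<inter> {t<..}) \<le> r"
    using assms by (intro cInf_lower bdd_belowI[of _ t]) auto
  then show ?thesis using assms by (auto simp: fwd_jump_def)
qed

lemma fwd_jump_in:
  assumes "closed T" "t \<in> T" shows "fwd_jump T t \<in> T"
proof (cases "T \<inter> {t<..} = {}")
  case True
  then have "Sup T = t" using assms by (intro cSup_eq_maximum) force+
  then show ?thesis using True assms by (simp add: fwd_jump_def)
next
  case False
  then have "Inf (T \<inter> {t<..}) \<in> closure (T \<inter> {t<..})"
    by (intro closure_contains_Inf bdd_belowI[of _ t]) auto
  also have "\<dots> \<subseteq> T" using assms(1) by (intro closure_minimal) auto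
  finally show ?thesis using False by (simp add: fwd_jump_def)
qed

lemma right_dense_approx:
  assumes "fwd_jump T t = t" "q \<in> T" "t < q" "0 < \<delta>"
  obtains r where "r \<in> T" "t < r" "r < t + \<delta>"
proof -
  have ne: "T \<inter> {t<..} \<noteq> {}" using assms by auto
  then have "Inf (T \<inter> {t<..}) < t + \<delta>"
    using assms(1,4) by (simp add: fwd_jump_def)
  then show ?thesis using cInf_lessD[OF ne] that by auto
qed

lemma left_dense_approx:
  assumes "left_dense T t" "q \<in> T" "q < t" "0 < \<delta>"
  obtains r where "r \<in> T" "t - \<delta> < r" "r < t"
proof -
  have ne: "T \<inter> {..<t} \<noteq> {}" using assms by auto
  then have "t - \<delta> < Sup (T \<inter> {..<t})"
    using assms(1,4) by (auto simp: left_dense_def bwd_jump_def)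
  then show ?thesis using less_cSupD[OF ne] that by auto
qed

lemma left_scattered_predecessor:
  assumes "closed T" "t \<in> T" "\<not> left_dense T t" "q \<in> T" "q < t"
  obtains r where "r \<in> T" "q \<le> r" "r < t" "fwd_jump T r = t" "T \<inter> {r<..<t} = {}"
proof -
  define r where "r = bwd_jump T t"
  have ne: "T \<inter> {..<t} \<noteq> {}" using assms by auto
  have bdd: "bdd_above (T \<inter> {..<t})" by (intro bdd_aboveI[of _ t]) auto
  have r: "r = Sup (T \<inter> {..<t})" using ne by (auto simp: r_def bwd_jump_def)
  have "r \<in> closure (T \<inter> {..<t})" unfolding r by (intro closure_contains_Sup ne bdd)
  also have "\<dots> \<subseteq> T" using assms(1) by (intro closure_minimal) auto
  finally have rT: "r \<in> T" .
  have "r \<le> t" unfolding r using ne by (intro cSup_least) auto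
  then have rt: "r < t" using assms(3) by (simp add: left_dense_def r_def)
  have up: "x \<le> r" if "x \<in> T" "x < t" for x
    unfolding r using that by (intro cSup_upper bdd) auto
  have emp: "T \<inter> {r<..<t} = {}" using up by force
  have "fwd_jump T r \<le> t" using assms(2) rt by (rule fwd_jump_le)
  moreover have "t \<le> Inf (T \<inter> {r<..})"
    using assms(2) rt up by (intro cInf_greatest) (auto simp: not_less[symmetric])
  moreover have "T \<inter> {r<..} \<noteq> {}" using assms(2) rt by auto
  ultimately have "fwd_jump T r = t" by (simp add: fwd_jump_def)
  then show ?thesis using that rT rt up[OF assms(4,5)] emp by blast
qed

lemma kappa_subset: "kappa T \<subseteq> T"
  by (auto simp: kappa_def)

lemma kappa_if_less:
  assumes "r \<in> T" "t \<in> T" "r < t" shows "r \<in> kappa T"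
proof -
  have "r \<noteq> Sup T" if "bdd_above T"
    using cSup_upper[OF assms(2) that] assms(3) by linarith
  then show ?thesis using assms by (auto simp: kappa_def)
qed

text \<open>Truncation removes at most the greatest point. Hence everything to the left of a
  surviving point survives as well, so to the left of its points \<open>kappa_pow T n\<close> agrees with \<open>T\<close>.\<close>

lemma kappa_downward:
  assumes "t \<in> kappa T" "r \<in> T" "r \<le> t" shows "r \<in> kappa T"
  using assms kappa_if_less[of r T t] kappa_subset by (cases "r = t") auto

lemma kappa_pow_Suc: "kappa_pow T (Suc n) = kappa (kappa_pow T n)"
  by (simp add: kappa_pow_def)

lemma kappa_pow_antimono:
  assumes "m \<le> n" shows "kappa_pow T n \<subseteq> kappa_pow T m"
  using assms
proof (induction n rule: dec_induct)
  case (step n)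
  then show ?case using kappa_subset by (auto simp: kappa_pow_Suc)
qed simp

lemma kappa_pow_subset: "kappa_pow T n \<subseteq> T"
  using kappa_pow_antimono[of 0 n T] by (simp add: kappa_pow_def)

lemma kappa_pow_downward:
  assumes "t \<in> kappa_pow T n" "r \<in> T" "r \<le> t" shows "r \<in> kappa_pow T n"
  using assms
proof (induction n)
  case 0
  then show ?case by (simp add: kappa_pow_def)
next
  case (Suc n)
  then have "t \<in> kappa (kappa_pow T n)" by (simp add: kappa_pow_Suc)
  moreover from this have "r \<in> kappa_pow T n" using Suc kappa_subset by blast
  ultimately show ?case using Suc.prems kappa_downward by (auto simp: kappa_pow_Suc)
qed

section \<open>Calculus of delta derivatives\<close>

text \<open>The definition says two different things at the two kinds of points. At a
  right-dense point it is the ordinary derivative within \<open>T\<close>. At a right-scattered point the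
  choice \<open>r = t\<close> forces the difference quotient over the gap, and the other \<open>r\<close> near \<open>t\<close> then
  force continuity. All further rules are read off from this description.\<close>

lemma has_delta_derivative_iff:
  assumes "t \<in> T"
  shows "has_delta_derivative T g l t \<longleftrightarrow>
    continuous (at t within T) g \<and>
    (if fwd_jump T t = t then (g has_real_derivative l) (at t within T)
     else g (fwd_jump T t) - g t = l * (fwd_jump T t - t))"
proof (cases "fwd_jump T t = t")
  case True
  have "has_delta_derivative T g l t \<longleftrightarrow> (g has_real_derivative l) (at t within T)"
    unfolding has_delta_derivative_def has_field_derivative_def has_derivative_within_alt True
    by (auto simp: bounded_linear_mult_right abs_minus_commute algebra_simps) 
  then show ?thesis using True DERIV_continuous by auto
next
  case False
  define s where "s = fwd_jump T t"
  have s: "t < s" using fwd_jump_ge[OF assms] False by (simp add: s_def)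
  show ?thesis
  proof (intro iffI)
    assume d: "has_delta_derivative T g l t"
    have le: "\<bar>(g s - g t) - l * (s - t)\<bar> \<le> e" if "e > 0" for e
    proof -
      have "e / (s - t) > 0" using that s by simp
      then have "\<bar>(g s - g t) - l * (s - t)\<bar> \<le> e / (s - t) * \<bar>s - t\<bar>"
        using d assms unfolding has_delta_derivative_def s_def[symmetric] by fastforce
      also have "\<dots> = e" using s by simp
      finally show ?thesis .
    qed
    have "\<bar>(g s - g t) - l * (s - t)\<bar> \<le> 0"
      by (rule field_le_epsilon) (simp only: add_0 le)
    then have jump: "g s - g t = l * (s - t)" by simp
    have "continuous (at t within T) g"
      unfolding continuous_within_eps_delta
    proof (intro allI impI)
      fix e :: real assume e: "e > 0"
      define u where "u = s - t + 1"
      have u: "u > 0" using s by (simp add: u_def)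
      define k where "k = e / (2 * u)"
      have k: "k > 0" using e u by (simp add: k_def)
      then obtain d1 where d1: "d1 > 0" "\<And>r. r \<in> T \<Longrightarrow> \<bar>r - t\<bar> < d1 \<Longrightarrow>
          \<bar>(g s - g r) - l * (s - r)\<bar> \<le> k * \<bar>s - r\<bar>"
        using d unfolding has_delta_derivative_def s_def[symmetric] by meson
      \<comment> \<open>the last entry keeps \<open>\<bar>l * (r - t)\<bar>\<close> below \<open>e / 2\<close>, the middle one bounds \<open>\<bar>s - r\<bar>\<close> by \<open>u\<close>\<close>
      define d2 where "d2 = Min {d1, 1, e / (2 * (\<bar>l\<bar> + 1))}"
      have d2: "d2 > 0" "d2 \<le> d1" "d2 \<le> 1" "d2 \<le> e / (2 * (\<bar>l\<bar> + 1))"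
        using d1 e by (auto simp: d2_def)
      have "dist (g r) (g t) < e" if "r \<in> T" "dist r t < d2" for r
      proof -
        have r: "\<bar>r - t\<bar> < d2" using that by (simp add: dist_real_def)
        have "\<bar>(g s - g r) - l * (s - r)\<bar> \<le> k * \<bar>s - r\<bar>" using d1(2) that r d2 by auto
        also have "\<dots> \<le> k * u" using k r d2 s by (intro mult_left_mono) (auto simp: u_def)
        also have "\<dots> = e / 2" using u by (simp add: k_def)
        finally have 1: "\<bar>(g s - g r) - l * (s - r)\<bar> \<le> e / 2" .
        have "\<bar>l\<bar> * \<bar>r - t\<bar> \<le> \<bar>l\<bar> * (e / (2 * (\<bar>l\<bar> + 1)))" using r d2 by (intro mult_left_mono) auto
        also have "\<dots> = e / 2 * (\<bar>l\<bar> / (\<bar>l\<bar> + 1))" by simp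
        also have "\<dots> < e / 2 * 1" using e by (intro mult_strict_left_mono) auto
        finally have 2: "\<bar>l * (r - t)\<bar> < e / 2" by (simp add: abs_mult)
        have "g r - g t = - ((g s - g r) - l * (s - r)) + l * (r - t)"
          using jump by (simp add: algebra_simps)
        then have "\<bar>g r - g t\<bar> \<le> \<bar>(g s - g r) - l * (s - r)\<bar> + \<bar>l * (r - t)\<bar>" by linarith
        then show ?thesis using 1 2 by (simp only: dist_real_def)
      qed
      then show "\<exists>d>0. \<forall>x'\<in>T. dist x' t < d \<longrightarrow> dist (g x') (g t) < e" using d2(1) by blast
    qed
    then show "continuous (at t within T) g \<and> (if fwd_jump T t = t
        then (g has_real_derivative l) (at t within T)
        else g (fwd_jump T t) - g t = l * (fwd_jump T t - t))"
      using jump False by (simp add: s_def)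
  next
    assume "continuous (at t within T) g \<and> (if fwd_jump T t = t
        then (g has_real_derivative l) (at t within T)
        else g (fwd_jump T t) - g t = l * (fwd_jump T t - t))"
    then have cont: "continuous (at t within T) g" and jump: "g s - g t = l * (s - t)"
      using False by (auto simp: s_def)
    have "continuous (at t within T) (\<lambda>r. (g s - g r) - l * (s - r))"
      by (intro continuous_intros cont)
    then have lim: "((\<lambda>r. (g s - g r) - l * (s - r)) \<longlongrightarrow> 0) (at t within T)"
      using jump by (simp add: continuous_within)
    show "has_delta_derivative T g l t"
      unfolding has_delta_derivative_def s_def[symmetric]
    proof (intro allI impI)
      fix e :: real assume e: "e > 0"
      have "e * ((s - t) / 2) > 0" using e s by simp
      then obtain d where d: "d > 0" "\<And>r. r \<in> T \<Longrightarrow> r \<noteq> t \<Longrightarrow> dist r t < d \<Longrightarrow>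
          \<bar>(g s - g r) - l * (s - r)\<bar> < e * ((s - t) / 2)"
        using lim[unfolded tendsto_iff eventually_at dist_real_def, rule_format, of "e * ((s - t) / 2)"]
        unfolding dist_real_def by (metis diff_zero)
      have "\<bar>(g s - g r) - l * (s - r)\<bar> \<le> e * \<bar>s - r\<bar>"
        if "r \<in> T" "\<bar>r - t\<bar> < min d ((s - t) / 2)" for r
      proof (cases "r = t")
        case True then show ?thesis using jump e by simp
      next
        case False
        then have "\<bar>(g s - g r) - l * (s - r)\<bar> \<le> e * ((s - t) / 2)"
          using d(2)[of r] that by (auto simp: dist_real_def)
        also have "\<dots> \<le> e * \<bar>s - r\<bar>"
        proof (rule mult_left_mono)
          show "(s - t) / 2 \<le> \<bar>s - r\<bar>"
            using conjunct2[OF that(2)[unfolded min_less_iff_conj]] s by (simp add: abs_if split: if_splits)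
        qed (use e in simp)
        finally show ?thesis .
      qed
      then show "\<exists>\<delta>>0. \<forall>r\<in>T. \<bar>r - t\<bar> < \<delta> \<longrightarrow> \<bar>g s - g r - l * (s - r)\<bar> \<le> e * \<bar>s - r\<bar>"
        using d(1) s by (intro exI[of _ "min d ((s - t) / 2)"]) auto
    qed
  qed
qed

lemma has_delta_derivative_continuous:
  "has_delta_derivative T g l t \<Longrightarrow> t \<in> T \<Longrightarrow> continuous (at t within T) g"
  by (simp add: has_delta_derivative_iff)

lemma has_delta_derivative_scattered:
  "has_delta_derivative T g l t \<Longrightarrow> t \<in> T \<Longrightarrow> g (fwd_jump T t) - g t = l * (fwd_jump T t - t)"
  by (auto simp: has_delta_derivative_iff split: if_splits)

lemma has_delta_derivative_const: "t \<in> T \<Longrightarrow> has_delta_derivative T (\<lambda>_. k) 0 t"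
  by (simp add: has_delta_derivative_iff)

lemma has_delta_derivative_add:
  assumes "t \<in> T" "has_delta_derivative T f k t" "has_delta_derivative T g l t"
  shows "has_delta_derivative T (\<lambda>x. f x + g x) (k + l) t"
  using assms by (auto simp: has_delta_derivative_iff algebra_simps
      intro!: continuous_intros derivative_eq_intros split: if_splits)

text \<open>The first factor is evaluated at the jump in the second term, as in
  \<open>f(\<sigma>) g(\<sigma>) - f g = (f(\<sigma>) - f) g + f(\<sigma>) (g(\<sigma>) - g)\<close>.\<close>

lemma has_delta_derivative_mult:
  assumes "t \<in> T" "has_delta_derivative T f k t" "has_delta_derivative T g l t"
  shows "has_delta_derivative T (\<lambda>x. f x * g x) (k * g t + f (fwd_jump T t) * l) t"
proof (cases "fwd_jump T t = t")
  case True
  then show ?thesis using assms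
    by (auto simp: has_delta_derivative_iff intro!: continuous_intros derivative_eq_intros)
next
  case False
  define s where "s = fwd_jump T t"
  have f: "f s - f t = k * (s - t)" and g: "g s - g t = l * (s - t)"
    using has_delta_derivative_scattered assms by (auto simp: s_def)
  have "f s * g s - f t * g t = (f s - f t) * g t + f s * (g s - g t)" by (simp add: algebra_simps)
  also have "\<dots> = (k * g t + f s * l) * (s - t)" unfolding f g by (simp add: algebra_simps)
  finally show ?thesis using assms False
    by (auto simp: has_delta_derivative_iff s_def intro!: continuous_intros)
qed

lemma has_delta_derivative_cmult:
  assumes "t \<in> T" "has_delta_derivative T g l t"
  shows "has_delta_derivative T (\<lambda>x. k * g x) (k * l) t"
  using has_delta_derivative_mult[OF assms(1) has_delta_derivative_const assms(2), of k] assms(1)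
  by simp

lemma has_delta_derivative_sum:
  assumes "t \<in> T" "\<And>i. i \<in> I \<Longrightarrow> has_delta_derivative T (g i) (l i) t"
  shows "has_delta_derivative T (\<lambda>x. \<Sum>i\<in>I. g i x) (\<Sum>i\<in>I. l i) t"
  using assms(2)
  by (induction I rule: infinite_finite_induct)
     (auto intro!: has_delta_derivative_add has_delta_derivative_const assms(1))

text \<open>A right-scattered point determines the quotient over its gap, and a
  right-dense point with larger points is an accumulation point. At the greatest point of \<open>T\<close>
  uniqueness can fail, hence the witness \<open>q\<close>.\<close>

lemma has_delta_derivative_unique:
  assumes "t \<in> T" "q \<in> T" "t < q" "has_delta_derivative T g k t" "has_delta_derivative T g l t"
  shows "k = l"
proof (cases "fwd_jump T t = t")
  case True
  have "\<exists>r\<in>T. r \<noteq> t \<and> dist r t < e" if "e > 0" for e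
    by (rule right_dense_approx[OF True assms(2,3) that]) (force simp: dist_real_def)
  then have "at t within T \<noteq> bot"
    by (simp add: trivial_limit_within islimpt_approachable)
  moreover have "(g has_real_derivative k) (at t within T)" "(g has_real_derivative l) (at t within T)"
    using assms True by (simp_all add: has_delta_derivative_iff)
  ultimately show ?thesis unfolding has_field_derivative_iff by (rule tendsto_unique)
next
  case False
  then show ?thesis using assms by (auto simp: has_delta_derivative_iff)
qed

text \<open>The jump of \<open>t\<close> never passes \<open>q\<close>, so both it and the derivative at \<open>t\<close> only see
  the part of the set up to \<open>q\<close>. This is how derivatives on a truncated time scale are compared with
  derivatives on \<open>T\<close>.\<close>

lemma fwd_jump_cong_below:
  assumes "S \<inter> {..q} = T \<inter> {..q}" "q \<in> T" "t < q"
  shows "fwd_jump S t = fwd_jump T t"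
proof -
  have Inf_restrict: "Inf (U \<inter> {t<..}) = Inf (U \<inter> {t<..} \<inter> {..q})" if "q \<in> U" for U
  proof (intro antisym cInf_mono)
    fix x assume "x \<in> U \<inter> {t<..}"
    then show "\<exists>z\<in>U \<inter> {t<..} \<inter> {..q}. z \<le> x" 
      using that assms(3) by (intro bexI[of _ "min x q"]) (auto simp: min_def)
  qed (use that assms(3) in \<open>auto intro!: bdd_belowI[of _ t] exI[of _ q]\<close>)
  have "q \<in> S" using assms by auto
  moreover have "S \<inter> {t<..} \<inter> {..q} = T \<inter> {t<..} \<inter> {..q}" using assms(1) by blast
  ultimately show ?thesis
    using Inf_restrict[of S] Inf_restrict[of T] assms by (auto simp: fwd_jump_def)
qed

lemma has_delta_derivative_cong_below:
  assumes "S \<inter> {..q} = T \<inter> {..q}" "q \<in> T" "t < q" "has_delta_derivative S g l t"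
  shows "has_delta_derivative T g l t"
  unfolding has_delta_derivative_def
proof (intro allI impI)
  fix e :: real assume e: "e > 0"
  have "\<forall>\<epsilon>>0. \<exists>\<delta>>0. \<forall>r\<in>S. \<bar>r - t\<bar> < \<delta> \<longrightarrow>
      \<bar>(g (fwd_jump T t) - g r) - l * (fwd_jump T t - r)\<bar> \<le> \<epsilon> * \<bar>fwd_jump T t - r\<bar>"
    using assms(4) by (simp only: has_delta_derivative_def fwd_jump_cong_below[OF assms(1-3)])
  from mp[OF spec[OF this] e] obtain d where d: "d > 0" "\<forall>r\<in>S. \<bar>r - t\<bar> < d \<longrightarrow>
      \<bar>(g (fwd_jump T t) - g r) - l * (fwd_jump T t - r)\<bar> \<le> e * \<bar>fwd_jump T t - r\<bar>"
    by (elim exE conjE)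
  have "r \<in> S" if "r \<in> T" "\<bar>r - t\<bar> < q - t" for r
  proof -
    have "r \<in> T \<inter> {..q}" using that by auto
    then show ?thesis using assms(1) by blast
  qed
  then show "\<exists>\<delta>>0. \<forall>r\<in>T. \<bar>r - t\<bar> < \<delta> \<longrightarrow>
      \<bar>(g (fwd_jump T t) - g r) - l * (fwd_jump T t - r)\<bar> \<le> e * \<bar>fwd_jump T t - r\<bar>"
    using d assms(3) by (intro exI[of _ "min d (q - t)"]) auto
qed

section \<open>Induction along a time scale and comparison of derivatives\<close>

text \<open>Consider the infimum of the points where \<open>P\<close> fails. It satisfies \<open>P\<close>, by the limit
  step if it is left-dense and by the scattered step from its predecessor otherwise. But then \<open>P\<close>
  persists beyond it, across its gap or on a right neighbourhood, and it is not the infimum.\<close>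

lemma time_scale_induct:
  assumes "closed T" "c \<in> T" "d \<in> T" "c \<le> d" "P c"
    and scattered: "\<And>x. x \<in> T \<Longrightarrow> c \<le> x \<Longrightarrow> x < d \<Longrightarrow> x < fwd_jump T x \<Longrightarrow> P x \<Longrightarrow> P (fwd_jump T x)"
    and dense: "\<And>x. x \<in> T \<Longrightarrow> c \<le> x \<Longrightarrow> x < d \<Longrightarrow> fwd_jump T x = x \<Longrightarrow> P x \<Longrightarrow>
      \<exists>\<delta>>0. \<forall>r\<in>T. x < r \<longrightarrow> r < x + \<delta> \<longrightarrow> P r"
    and limit: "\<And>x. x \<in> T \<Longrightarrow> c < x \<Longrightarrow> x \<le> d \<Longrightarrow> left_dense T x \<Longrightarrow>
      (\<And>r. r \<in> T \<Longrightarrow> c \<le> r \<Longrightarrow> r < x \<Longrightarrow> P r) \<Longrightarrow> P x"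
  shows "P d"
proof (rule ccontr)
  assume nd: "\<not> P d"
  define B where "B = {x \<in> T. c \<le> x \<and> x \<le> d \<and> \<not> P x}"
  define m where "m = Inf B"
  have ne: "B \<noteq> {}" using nd assms by (auto simp: B_def)
  have bdd: "bdd_below B" by (intro bdd_belowI[of _ c]) (auto simp: B_def)
  have "m \<in> closure B" unfolding m_def by (intro closure_contains_Inf ne bdd)
  also have "\<dots> \<subseteq> T" using assms(1) by (intro closure_minimal) (auto simp: B_def)
  finally have mT: "m \<in> T" .
  have cm: "c \<le> m" unfolding m_def using ne by (intro cInf_greatest) (auto simp: B_def)
  have lower: "m \<le> x" if "x \<in> B" for x unfolding m_def by (intro cInf_lower that bdd)
  have md: "m \<le> d" using lower[of d] nd assms by (auto simp: B_def)
  have below: "P r" if "r \<in> T" "c \<le> r" "r < m" for r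
    using lower[of r] that md by (force simp: B_def)
  have Pm: "P m"
  proof (cases "m = c")
    case False
    then have "c < m" using cm by simp
    show ?thesis
    proof (cases "left_dense T m")
      case True
      then show ?thesis using limit[OF mT \<open>c < m\<close> md] below by blast
    next
      case False
      obtain r where "r \<in> T" "c \<le> r" "r < m" "fwd_jump T r = m"
        using left_scattered_predecessor[OF assms(1) mT False assms(2) \<open>c < m\<close>] by metis
      then show ?thesis using scattered[of r] below[of r] md by auto
    qed
  qed (use assms in simp)
  then have "m < d" using nd md by (cases "m = d") auto
  have "\<exists>u>m. \<forall>x\<in>B. u \<le> x"
  proof (cases "fwd_jump T m = m")
    case True
    then obtain e where e: "e > 0" "\<And>r. r \<in> T \<Longrightarrow> m < r \<Longrightarrow> r < m + e \<Longrightarrow> P r"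
      using dense[OF mT cm \<open>m < d\<close> _ Pm] by blast
    have "m + e \<le> x" if "x \<in> B" for x
      using e(2)[of x] lower[OF that] Pm that by (cases "x = m") (force simp: B_def)+
    then show ?thesis using e(1) by (intro exI[of _ "m + e"]) auto
  next
    case False
    then have "m < fwd_jump T m" using fwd_jump_ge[OF mT] by simp
    moreover have "fwd_jump T m \<le> x" if "x \<in> B" for x
      using fwd_jump_le[of x T m] lower[OF that] Pm that by (cases "x = m") (auto simp: B_def)
    ultimately show ?thesis by blast
  qed
  then obtain u where u: "m < u" "\<And>x. x \<in> B \<Longrightarrow> u \<le> x" by blast
  have "u \<le> m" unfolding m_def by (rule cInf_greatest[OF ne u(2)])
  then show False using u(1) by simp
qed

text \<open>By induction along the time scale, \<open>u\<close> falls from \<open>c\<close> to \<open>x\<close> by at most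
  \<open>e (x - c)\<close>. The slack \<open>e\<close> absorbs the error term of the derivative at right-dense points.\<close>

lemma delta_derivative_nonneg_imp_le:
  assumes "closed T" "c \<in> T" "d \<in> T" "c \<le> d"
    and cont: "continuous_on (T \<inter> {c..d}) u"
    and der: "\<And>r. r \<in> T \<Longrightarrow> c \<le> r \<Longrightarrow> r < d \<Longrightarrow> has_delta_derivative T u (v r) r"
    and nonneg: "\<And>r. r \<in> T \<Longrightarrow> c \<le> r \<Longrightarrow> r < d \<Longrightarrow> 0 \<le> v r"
  shows "u c \<le> u d"
proof (rule field_le_epsilon)
  fix \<epsilon> :: real assume \<epsilon>: "0 < \<epsilon>"
  \<comment> \<open>the summand \<open>1\<close> keeps the denominator positive when \<open>c = d\<close>\<close>
  define e where "e = \<epsilon> / (d - c + 1)"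
  have e: "e > 0" using \<epsilon> assms(4) by (simp add: e_def)
  have "u c \<le> u d + e * (d - c)"
  proof (rule time_scale_induct[OF assms(1-4), where P = "\<lambda>x. u c \<le> u x + e * (x - c)"])
    fix x assume x: "x \<in> T" "c \<le> x" "x < d" "x < fwd_jump T x" "u c \<le> u x + e * (x - c)"
    have "u (fwd_jump T x) - u x = v x * (fwd_jump T x - x)"
      using has_delta_derivative_scattered[OF der] x by blast
    moreover have "v x * (fwd_jump T x - x) \<ge> 0" using nonneg x by simp
    moreover have "e * (x - c) \<le> e * (fwd_jump T x - c)" using e x by simp
    ultimately show "u c \<le> u (fwd_jump T x) + e * (fwd_jump T x - c)" using x by linarith
  next
    fix x assume x: "x \<in> T" "c \<le> x" "x < d" "fwd_jump T x = x" "u c \<le> u x + e * (x - c)"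
    obtain \<delta> where \<delta>: "\<delta> > 0" and
      bound: "\<forall>r\<in>T. \<bar>r - x\<bar> < \<delta> \<longrightarrow> \<bar>(u x - u r) - v x * (x - r)\<bar> \<le> e * \<bar>x - r\<bar>"
      using der[OF x(1-3)] e unfolding has_delta_derivative_def x(4) by blast
    have "u c \<le> u r + e * (r - c)" if r: "r \<in> T" "x < r" "r < x + \<delta>" for r
    proof -
      have "\<bar>r - x\<bar> < \<delta>" using r by simp
      then have "\<bar>(u x - u r) - v x * (x - r)\<bar> \<le> e * \<bar>x - r\<bar>" using bound r(1) by blast
      also have "\<dots> = e * (r - c) - e * (x - c)" using r by (simp add: algebra_simps)
      finally have "\<bar>(u x - u r) - v x * (x - r)\<bar> \<le> e * (r - c) - e * (x - c)" .
      moreover have "v x * (x - r) \<le> 0" using nonneg[OF x(1-3)] r by (simp add: mult_nonneg_nonpos)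
      ultimately show ?thesis using x(5) by linarith
    qed
    then show "\<exists>\<delta>>0. \<forall>r\<in>T. x < r \<longrightarrow> r < x + \<delta> \<longrightarrow> u c \<le> u r + e * (r - c)"
      using \<delta> by blast
  next
    fix x assume x: "x \<in> T" "c < x" "x \<le> d" "left_dense T x"
      and below: "\<And>r. r \<in> T \<Longrightarrow> c \<le> r \<Longrightarrow> r < x \<Longrightarrow> u c \<le> u r + e * (r - c)"
    show "u c \<le> u x + e * (x - c)"
    proof (rule ccontr)
      assume n: "\<not> u c \<le> u x + e * (x - c)"
      define w where "w = (\<lambda>r. u r + e * (r - c))"
      have "continuous_on (T \<inter> {c..d}) w" unfolding w_def by (intro continuous_intros cont)
      moreover have "0 < u c - w x" using n by (simp add: w_def)
      moreover have "x \<in> T \<inter> {c..d}" using x by simp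
      ultimately obtain \<delta> where \<delta>: "\<delta> > 0"
        "\<forall>r\<in>T \<inter> {c..d}. dist r x < \<delta> \<longrightarrow> dist (w r) (w x) < u c - w x"
        unfolding continuous_on_iff by blast
      have "0 < min \<delta> (x - c)" using \<delta> x by simp
      then obtain r where r: "r \<in> T" "x - min \<delta> (x - c) < r" "r < x"
        using left_dense_approx[OF x(4) assms(2) x(2)] by blast
      have "dist r x < \<delta>" "c \<le> r" "r \<in> T \<inter> {c..d}"
        using r x by (auto simp: dist_real_def min_def split: if_splits)
      then have "dist (w r) (w x) < u c - w x" using \<delta>(2) by blast
      then have "w r < u c" by (simp add: dist_real_def abs_less_iff)
      then show False using below[OF r(1) \<open>c \<le> r\<close> r(3)] by (simp add: w_def)
    qed
  qed simp
  also have "e * (d - c) \<le> e * (d - c + 1)" using e by simp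
  also have "\<dots> = \<epsilon>" using assms(4) by (simp add: e_def)
  finally show "u c \<le> u d + \<epsilon>" by simp
qed

text \<open>Both \<open>G + F\<close> and \<open>G - F\<close> have nonnegative derivative. With \<open>g = 0\<close> this gives
  uniqueness of antiderivatives up to constants.\<close>

lemma delta_derivative_comparison:
  assumes "closed T" "c \<in> T" "d \<in> T" "c \<le> d"
    and "continuous_on (T \<inter> {c..d}) F" "continuous_on (T \<inter> {c..d}) G"
    and F: "\<And>r. r \<in> T \<Longrightarrow> c \<le> r \<Longrightarrow> r < d \<Longrightarrow> has_delta_derivative T F (f r) r"
    and G: "\<And>r. r \<in> T \<Longrightarrow> c \<le> r \<Longrightarrow> r < d \<Longrightarrow> has_delta_derivative T G (g r) r"
    and le: "\<And>r. r \<in> T \<Longrightarrow> c \<le> r \<Longrightarrow> r < d \<Longrightarrow> \<bar>f r\<bar> \<le> g r"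
  shows "\<bar>F d - F c\<bar> \<le> G d - G c"
proof -
  have "G c + k * F c \<le> G d + k * F d" if k: "\<bar>k\<bar> = 1" for k
  proof (rule delta_derivative_nonneg_imp_le[OF assms(1-4), where v = "\<lambda>r. g r + k * f r"])
    show "continuous_on (T \<inter> {c..d}) (\<lambda>x. G x + k * F x)"
      by (intro continuous_intros assms)
    show "has_delta_derivative T (\<lambda>x. G x + k * F x) (g r + k * f r) r"
      if "r \<in> T" "c \<le> r" "r < d" for r
      using that by (intro has_delta_derivative_add has_delta_derivative_cmult F G)
    show "0 \<le> g r + k * f r" if "r \<in> T" "c \<le> r" "r < d" for r
    proof -
      have "\<bar>k * f r\<bar> \<le> g r" using le[OF that] k by (simp add: abs_mult)
      then show ?thesis by linarith
    qed
  qed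
  from this[of 1] this[of "-1"] show ?thesis by auto
qed

text \<open>The derivative is only prescribed on \<open>kappa T\<close>, but a point lost by truncation is
  isolated in \<open>T\<close>.\<close>

lemma antiderivative_continuous:
  assumes "closed T" "delta_antiderivative T f F"
  shows "continuous_on T F"
  unfolding continuous_on_eq_continuous_within
proof
  fix t assume t: "t \<in> T"
  show "continuous (at t within T) F"
  proof (cases "t \<in> kappa T")
    case True
    then show ?thesis using assms t
      by (auto simp: delta_antiderivative_def intro: has_delta_derivative_continuous)
  next
    case False
    then have max: "bdd_above T" "t = Sup T" "bwd_jump T t \<noteq> t" using t
      by (auto simp: kappa_def split: if_splits)
    have nd: "\<not> left_dense T t" using max by (simp add: left_dense_def)
    have "\<exists>q\<in>T. q < t"
    proof (rule ccontr)
      assume n: "\<not> (\<exists>q\<in>T. q < t)"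
      then have "Inf T = t" using t by (intro cInf_eq_minimum) auto
      moreover have "T \<inter> {..<t} = {}" using n by auto
      ultimately show False using max by (simp add: bwd_jump_def)
    qed
    then obtain r where r: "r < t" "T \<inter> {r<..<t} = {}"
      using left_scattered_predecessor[OF assms(1) t nd] by metis
    have "x = t" if "x \<in> T" "dist x t < t - r" for x
    proof -
      have "x \<le> t" using max that cSup_upper by blast
      then show ?thesis using r that by (auto simp: dist_real_def)
    qed
    then show ?thesis unfolding continuous_within_eps_delta
      using r(1) by (metis diff_gt_0_iff_gt dist_self)
  qed
qed

text \<open>The derivative of \<open>F\<close> is only required on the half-open interval. This matters
  for functions that are differentiable up to, but perhaps not beyond, the point \<open>d\<close>.\<close>

lemma antiderivative_shift_unique:
  assumes "closed T" "c \<in> T" "d \<in> T" "c \<le> d"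
    and G: "delta_antiderivative T g G"
    and cont: "continuous_on (T \<inter> {c..d}) F"
    and F: "\<And>r. r \<in> T \<Longrightarrow> c \<le> r \<Longrightarrow> r < d \<Longrightarrow> has_delta_derivative T F (f r) r"
    and eq: "\<And>r. r \<in> T \<Longrightarrow> c \<le> r \<Longrightarrow> r < d \<Longrightarrow> f r = g r"
  shows "F d - F c = G d - G c"
proof -
  have "\<bar>(F d + (-1) * G d) - (F c + (-1) * G c)\<bar> \<le> 0 - 0"
  proof (rule delta_derivative_comparison[OF assms(1-4)])
    show "continuous_on (T \<inter> {c..d}) (\<lambda>x. F x + (-1) * G x)"
      by (intro continuous_intros cont continuous_on_subset[OF antiderivative_continuous[OF assms(1) G]]) auto
    show "has_delta_derivative T (\<lambda>x. F x + (-1) * G x) 0 r"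
      if "r \<in> T" "c \<le> r" "r < d" for r
    proof -
      have "r \<in> kappa T" using kappa_if_less that assms by blast
      then have "has_delta_derivative T G (g r) r" using G by (simp add: delta_antiderivative_def)
      from has_delta_derivative_add[OF that(1) F[OF that] has_delta_derivative_cmult[OF that(1) this, of "-1"]]
      show ?thesis using eq[OF that] by simp
    qed
  qed (auto intro: has_delta_derivative_const)
  then show ?thesis by simp
qed

section \<open>Rd-continuous functions\<close>

lemma rd_continuous_if_continuous: "continuous_on T f \<Longrightarrow> rd_continuous T f"
  unfolding rd_continuous_def continuous_on_def continuous_within
  by (meson Int_lower1 tendsto_within_subset)

lemma rd_continuous_const: "rd_continuous T (\<lambda>_. k)"
  by (simp add: rd_continuous_if_continuous)

lemma rd_continuous_add:
  assumes "rd_continuous T f" "rd_continuous T g"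
  shows "rd_continuous T (\<lambda>x. f x + g x)"
  unfolding rd_continuous_def
proof (intro conjI ballI impI)
  fix t assume t: "t \<in> T"
  show "continuous (at t within T) (\<lambda>x. f x + g x)" if "right_dense T t"
    using assms t that by (intro continuous_add) (auto simp: rd_continuous_def)
  assume "left_dense T t"
  then obtain L M where "(f \<longlongrightarrow> L) (at t within T \<inter> {..<t})" "(g \<longlongrightarrow> M) (at t within T \<inter> {..<t})"
    using assms t unfolding rd_continuous_def by meson
  from tendsto_add[OF this] show "\<exists>L. ((\<lambda>x. f x + g x) \<longlongrightarrow> L) (at t within T \<inter> {..<t})" ..
qed

lemma rd_continuous_mult:
  assumes "rd_continuous T f" "rd_continuous T g"
  shows "rd_continuous T (\<lambda>x. f x * g x)"
  unfolding rd_continuous_def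
proof (intro conjI ballI impI)
  fix t assume t: "t \<in> T"
  show "continuous (at t within T) (\<lambda>x. f x * g x)" if "right_dense T t"
    using assms t that by (intro continuous_mult) (auto simp: rd_continuous_def)
  assume "left_dense T t"
  then obtain L M where "(f \<longlongrightarrow> L) (at t within T \<inter> {..<t})" "(g \<longlongrightarrow> M) (at t within T \<inter> {..<t})"
    using assms t unfolding rd_continuous_def by meson
  from tendsto_mult[OF this] show "\<exists>L. ((\<lambda>x. f x * g x) \<longlongrightarrow> L) (at t within T \<inter> {..<t})" ..
qed

lemma rd_continuous_sum:
  assumes "\<And>i. i \<in> I \<Longrightarrow> rd_continuous T (f i)"
  shows "rd_continuous T (\<lambda>x. \<Sum>i\<in>I. f i x)"
  using assms by (induction I rule: infinite_finite_induct)
    (auto intro: rd_continuous_const rd_continuous_add)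

text \<open>At a left-dense point \<open>t\<close> the jumps of points \<open>r < t\<close> stay between \<open>r\<close> and \<open>t\<close>. At a
  right-dense point a slightly larger \<open>q \<in> T\<close> bounds the jumps of all points below \<open>q\<close>.\<close>

lemma rd_continuous_fwd_jump:
  assumes "closed T" "continuous_on T f"
  shows "rd_continuous T (\<lambda>x. f (fwd_jump T x))"
  unfolding rd_continuous_def
proof (intro conjI ballI impI)
  fix t assume t: "t \<in> T"
  have near: "\<exists>\<delta>>0. \<forall>r\<in>T. dist r t < \<delta> \<longrightarrow> dist (f r) (f t) < e" if "e > 0" for e
    using assms(2) t that unfolding continuous_on_iff by blast
  have left: "dist (f (fwd_jump T r)) (f t) < e"
    if "\<forall>r\<in>T. dist r t < \<delta> \<longrightarrow> dist (f r) (f t) < e" "r \<in> T" "r < t" "dist r t < \<delta>" for r e \<delta>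
  proof -
    have "r \<le> fwd_jump T r" "fwd_jump T r \<le> t" using fwd_jump_ge fwd_jump_le that t by auto
    then show ?thesis using that fwd_jump_in[OF assms(1) that(2)] by (auto simp: dist_real_def)
  qed
  show "continuous (at t within T) (\<lambda>x. f (fwd_jump T x))" if rd: "right_dense T t"
    unfolding continuous_within_eps_delta
  proof (intro allI impI)
    fix e :: real assume "e > 0"
    then obtain \<delta> where \<delta>: "\<delta> > 0" "\<forall>r\<in>T. dist r t < \<delta> \<longrightarrow> dist (f r) (f t) < e"
      using near by blast
    have jt: "fwd_jump T t = t" using rd by (simp add: right_dense_def)
    have "\<exists>d>0. d \<le> \<delta> \<and> (\<forall>r\<in>T. t < r \<longrightarrow> r < t + d \<longrightarrow> fwd_jump T r < t + \<delta>)"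
    proof (cases "\<exists>q\<in>T. t < q")
      case True
      then obtain q where q: "q \<in> T" "t < q" "q < t + \<delta>"
        using right_dense_approx[OF jt _ _ \<delta>(1)] by blast
      have "fwd_jump T r < t + \<delta>" if "r \<in> T" "r < q" for r
        using fwd_jump_le[OF q(1) that(2)] q by simp
      then show ?thesis using q by (intro exI[of _ "q - t"]) auto
    next
      case False
      then show ?thesis using \<delta> by auto
    qed
    then obtain d where d: "d > 0" "d \<le> \<delta>"
      "\<And>r. r \<in> T \<Longrightarrow> t < r \<Longrightarrow> r < t + d \<Longrightarrow> fwd_jump T r < t + \<delta>" by blast
    have "dist (f (fwd_jump T r)) (f (fwd_jump T t)) < e" if r: "r \<in> T" "dist r t < d" for r
    proof -
      consider "r < t" | "r = t" | "t < r" by linarith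
      then show ?thesis
      proof cases
        case 1 then show ?thesis using left[OF \<delta>(2)] r d jt by simp
      next
        case 2 then show ?thesis using \<open>e > 0\<close> by simp
      next
        case 3
        then have "fwd_jump T r < t + \<delta>" "r \<le> fwd_jump T r"
          using d(3)[of r] fwd_jump_ge r by (auto simp: dist_real_def)
        then show ?thesis
          using 3 \<delta>(2) fwd_jump_in[OF assms(1) r(1)] jt by (auto simp: dist_real_def)
      qed
    qed
    then show "\<exists>d>0. \<forall>x'\<in>T. dist x' t < d \<longrightarrow>
        dist (f (fwd_jump T x')) (f (fwd_jump T t)) < e" using d(1) by blast
  qed
  have "((\<lambda>x. f (fwd_jump T x)) \<longlongrightarrow> f t) (at t within T \<inter> {..<t})"
    unfolding tendsto_iff eventually_at
  proof (intro allI impI)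
    fix e :: real assume "e > 0"
    then obtain \<delta> where \<delta>: "\<delta> > 0" "\<forall>r\<in>T. dist r t < \<delta> \<longrightarrow> dist (f r) (f t) < e"
      using near by blast
    then show "\<exists>d>0. \<forall>x\<in>T \<inter> {..<t}. x \<noteq> t \<and> dist x t < d \<longrightarrow>
        dist (f (fwd_jump T x)) (f t) < e"
      using left[OF \<delta>(2)] by auto
  qed
  then show "\<exists>L. ((\<lambda>x. f (fwd_jump T x)) \<longlongrightarrow> L) (at t within T \<inter> {..<t})" ..
qed

lemma rd_continuous_locally_bounded:
  assumes "closed T" "rd_continuous T f" "t \<in> T"
  shows "\<exists>\<delta>>0. bounded (f ` (T \<inter> ball t \<delta>))"
proof -
  have right: "\<exists>\<delta>>0. \<exists>B. \<forall>r\<in>T. t < r \<longrightarrow> r < t + \<delta> \<longrightarrow> \<bar>f r\<bar> \<le> B"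
  proof (cases "fwd_jump T t = t")
    case True
    then have "continuous (at t within T) f"
      using assms by (auto simp: rd_continuous_def right_dense_def)
    then obtain \<delta> where \<delta>: "\<delta> > 0" "\<forall>r\<in>T. dist r t < \<delta> \<longrightarrow> dist (f r) (f t) < 1"
      unfolding continuous_within_eps_delta using zero_less_one by blast
    have "\<bar>f r\<bar> \<le> \<bar>f t\<bar> + 1" if "r \<in> T" "t < r" "r < t + \<delta>" for r
    proof -
      have "dist (f r) (f t) < 1" using \<delta>(2) that by (auto simp: dist_real_def)
      then show ?thesis by (simp add: dist_real_def)
    qed
    then show ?thesis using \<delta>(1) by blast
  next
    case False
    then have "fwd_jump T t - t > 0" using fwd_jump_ge[OF assms(3)] by simp
    moreover have "\<not> (t < r \<and> r < t + (fwd_jump T t - t))" if "r \<in> T" for r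
      using fwd_jump_le[OF that, of t] by auto
    ultimately show ?thesis by blast
  qed
  have left: "\<exists>\<delta>>0. \<exists>B. \<forall>r\<in>T. t - \<delta> < r \<longrightarrow> r < t \<longrightarrow> \<bar>f r\<bar> \<le> B"
  proof (cases "left_dense T t")
    case True
    then obtain L where "(f \<longlongrightarrow> L) (at t within T \<inter> {..<t})"
      using assms by (auto simp: rd_continuous_def)
    then obtain \<delta> where \<delta>: "\<delta> > 0"
      "\<forall>r\<in>T \<inter> {..<t}. r \<noteq> t \<and> dist r t < \<delta> \<longrightarrow> dist (f r) L < 1"
      unfolding tendsto_iff eventually_at using zero_less_one by blast
    have "\<bar>f r\<bar> \<le> \<bar>L\<bar> + 1" if "r \<in> T" "t - \<delta> < r" "r < t" for r
    proof -
      have "dist (f r) L < 1" using \<delta>(2) that by (auto simp: dist_real_def)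
      then show ?thesis by (simp add: dist_real_def)
    qed
    then show ?thesis using \<delta>(1) by blast
  next
    case False
    show ?thesis
    proof (cases "\<exists>q\<in>T. q < t")
      case True
      then obtain r where r: "r < t" "T \<inter> {r<..<t} = {}"
        using left_scattered_predecessor[OF assms(1,3) False] by metis
      then have "t - r > 0" "\<forall>x\<in>T. \<not> (t - (t - r) < x \<and> x < t)" by auto
      then show ?thesis by blast
    next
      case False
      then show ?thesis using zero_less_one by blast
    qed
  qed
  obtain d1 B1 where 1: "d1 > 0" "\<And>r. r \<in> T \<Longrightarrow> t < r \<Longrightarrow> r < t + d1 \<Longrightarrow> \<bar>f r\<bar> \<le> B1"
    using right by blast
  obtain d2 B2 where 2: "d2 > 0" "\<And>r. r \<in> T \<Longrightarrow> t - d2 < r \<Longrightarrow> r < t \<Longrightarrow> \<bar>f r\<bar> \<le> B2"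
    using left by blast
  have "\<bar>f r\<bar> \<le> max \<bar>f t\<bar> (max B1 B2)" if "r \<in> T \<inter> ball t (min d1 d2)" for r
    using 1(2)[of r] 2(2)[of r] that by (cases r t rule: linorder_cases) (auto simp: dist_real_def)
  then have "bounded (f ` (T \<inter> ball t (min d1 d2)))"
    unfolding bounded_iff by (auto intro!: exI[of _ "max \<bar>f t\<bar> (max B1 B2)"])
  then show ?thesis using 1(1) 2(1) by (intro exI[of _ "min d1 d2"]) auto
qed

text \<open>One-sided limits or gaps give local bounds on both sides of each point, and
  \<open>T \<inter> {\<alpha>..\<beta>}\<close> is compact.\<close>

lemma rd_continuous_bounded:
  assumes "closed T" "rd_continuous T f"
  obtains B where "B \<ge> 0" "\<And>r. r \<in> T \<Longrightarrow> \<alpha> \<le> r \<Longrightarrow> r \<le> \<beta> \<Longrightarrow> \<bar>f r\<bar> \<le> B"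
proof -
  obtain \<delta> where \<delta>: "\<And>t. t \<in> T \<Longrightarrow> \<delta> t > 0" "\<And>t. t \<in> T \<Longrightarrow> bounded (f ` (T \<inter> ball t (\<delta> t)))"
    using rd_continuous_locally_bounded[OF assms] by metis
  have "compact (T \<inter> {\<alpha>..\<beta>})" using assms(1) by (simp add: closed_Int_compact)
  moreover have "open (ball t (\<delta> t))" for t by simp
  moreover have "T \<inter> {\<alpha>..\<beta>} \<subseteq> (\<Union>t\<in>T. ball t (\<delta> t))" using \<delta>(1) by force
  ultimately obtain D where D: "D \<subseteq> T" "finite D" "T \<inter> {\<alpha>..\<beta>} \<subseteq> (\<Union>t\<in>D. ball t (\<delta> t))"
    by (rule compactE_image)
  have "bounded (\<Union>t\<in>D. f ` (T \<inter> ball t (\<delta> t)))"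
    using D \<delta>(2) by (intro bounded_UN) auto
  moreover have "f ` (T \<inter> {\<alpha>..\<beta>}) \<subseteq> (\<Union>t\<in>D. f ` (T \<inter> ball t (\<delta> t)))" using D(3) by blast
  ultimately have "bounded (f ` (T \<inter> {\<alpha>..\<beta>}))" by (rule bounded_subset)
  then obtain B where B: "\<And>x. x \<in> f ` (T \<inter> {\<alpha>..\<beta>}) \<Longrightarrow> \<bar>x\<bar> \<le> B"
    unfolding bounded_real by blast
  show ?thesis
    by (rule that[of "\<bar>B\<bar>"]) (auto intro: order_trans[OF B])
qed

section \<open>Existence of antiderivatives\<close>

text \<open>Composing a function on \<open>T\<close> with \<open>last_before T\<close> extends it to the line as a constant on each gap.
  The delta integral of the function is the ordinary integral of this step extension. For a point
  below \<open>T\<close> the value is the arbitrary supremum of the empty set.\<close>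

definition last_before :: "real set \<Rightarrow> real \<Rightarrow> real" where
  "last_before T x = Sup (T \<inter> {..x})"

lemma last_before_self: "x \<in> T \<Longrightarrow> last_before T x = x"
  unfolding last_before_def by (intro cSup_eq_maximum) auto

lemma last_before_upper: "r \<in> T \<Longrightarrow> r \<le> x \<Longrightarrow> r \<le> last_before T x"
  unfolding last_before_def by (intro cSup_upper bdd_aboveI[of _ x]) auto

lemma last_before_le: "c \<in> T \<Longrightarrow> c \<le> x \<Longrightarrow> last_before T x \<le> x"
  unfolding last_before_def by (intro cSup_least) auto

lemma last_before_in:
  assumes "closed T" "c \<in> T" "c \<le> x" shows "last_before T x \<in> T"
proof -
  have "last_before T x \<in> closure (T \<inter> {..x})"
    unfolding last_before_def using assms
    by (intro closure_contains_Sup bdd_aboveI[of _ x]) auto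
  also have "\<dots> \<subseteq> T" using assms(1) by (intro closure_minimal) auto
  finally show ?thesis .
qed

text \<open>The gaps to the right of these points are disjoint nonempty open intervals.\<close>

lemma countable_right_scattered: "countable {x \<in> T. fwd_jump T x \<noteq> x}"
proof -
  define R where "R = {x \<in> T. fwd_jump T x \<noteq> x}"
  define gap where "gap = (\<lambda>x. {x<..<fwd_jump T x})"
  have ne: "gap x \<noteq> {}" if "x \<in> R" for x
    using that fwd_jump_ge[of x T] by (auto simp: gap_def R_def)
  have disj: "disjnt (gap x) (gap z)" if "x \<in> R" "z \<in> R" "x < z" for x z
    using that fwd_jump_le[of z T x] by (auto simp: gap_def R_def disjnt_def)
  have disj': "disjnt (gap x) (gap z)" if "x \<in> R" "z \<in> R" "x \<noteq> z" for x z
    using disj[of x z] disj[of z x] that by (cases x z rule: linorder_cases) (auto simp: disjnt_sym)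
  have inj: "inj_on gap R"
    using disj' ne unfolding inj_on_def disjnt_def by (metis inf.idem)
  have "countable (gap ` R)"
  proof (rule countable_disjoint_open_subsets)
    show "pairwise disjnt (gap ` R)"
      unfolding pairwise_def using disj' by blast
  qed (auto simp: gap_def)
  then show ?thesis using countable_image_inj_on inj unfolding R_def by blast
qed

text \<open>The step extension is continuous off the endpoints of the gaps, which
  are countably many.\<close>

lemma rd_continuous_step_measurable:
  assumes "closed T" "rd_continuous T f"
  shows "(\<lambda>x. f (last_before T x)) \<in> borel_measurable borel"
proof -
  define R where "R = {x \<in> T. fwd_jump T x \<noteq> x}"
  \<comment> \<open>right endpoints of gaps are jumps of right-scattered points; below the least point of
    \<open>T\<close>, if there is one, the extension is arbitrary\<close>
  define X where "X = insert (Inf T) (R \<union> fwd_jump T ` R)"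
  have "countable X" unfolding X_def R_def using countable_right_scattered by simp
  moreover have "continuous_on (- X) (\<lambda>x. f (last_before T x))"
  proof (rule continuous_at_imp_continuous_on, rule ballI)
    fix x assume x: "x \<in> - X"
    show "continuous (at x) (\<lambda>x. f (last_before T x))"
    proof (cases "x \<in> T")
      case False
      have "open (- T)" using assms(1) by (rule open_Compl)
      moreover have "x \<in> - T" using False by simp
      ultimately obtain e where e: "e > 0" "ball x e \<subseteq> - T" by (rule openE)
      have "last_before T z = last_before T x" if "dist z x < e" for z
      proof -
        have far: "\<not> \<bar>w - x\<bar> < e" if "w \<in> T" for w
          using e(2) that by (force simp: dist_real_def)
        have "w \<le> z \<longleftrightarrow> w \<le> x" if "w \<in> T" for w
          using far[OF that] \<open>dist z x < e\<close> unfolding dist_real_def by linarith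
        then have "T \<inter> {..z} = T \<inter> {..x}" by blast
        then show ?thesis by (simp add: last_before_def)
      qed
      then show ?thesis unfolding continuous_at_eps_delta using e(1) by (metis dist_self)
    next
      case True
      then have rd: "fwd_jump T x = x" using x by (auto simp: X_def R_def)
      have "\<exists>q\<in>T. q < x"
      proof (rule ccontr)
        assume "\<not> (\<exists>q\<in>T. q < x)"
        then have "Inf T = x" using True by (intro cInf_eq_minimum) auto
        then show False using x by (simp add: X_def)
      qed
      then obtain q where q: "q \<in> T" "q < x" by blast
      have ld: "left_dense T x"
      proof (rule ccontr)
        assume "\<not> left_dense T x"
        then obtain r where "r \<in> T" "r < x" "fwd_jump T r = x"
          using left_scattered_predecessor[OF assms(1) True _ q] by metis
        then have "x \<in> fwd_jump T ` R" by (force simp: R_def)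
        then show False using x by (simp add: X_def)
      qed
      have cont: "continuous (at x within T) f"
        using assms True rd by (auto simp: rd_continuous_def right_dense_def)
      show ?thesis unfolding continuous_at_eps_delta
      proof (intro allI impI)
        fix e :: real assume "e > 0"
        then obtain \<delta> where \<delta>: "\<delta> > 0" "\<forall>r\<in>T. dist r x < \<delta> \<longrightarrow> dist (f r) (f x) < e"
          using cont unfolding continuous_within_eps_delta by blast
        obtain r0 where r0: "r0 \<in> T" "x - \<delta> < r0" "r0 < x"
          using left_dense_approx[OF ld q \<delta>(1)] by blast
        have "dist (f (last_before T z)) (f (last_before T x)) < e" if "dist z x < x - r0" for z
        proof -
          have z: "r0 \<le> z" "z < x + \<delta>" using that r0 by (auto simp: dist_real_def)
          have "last_before T z \<in> T" "r0 \<le> last_before T z" "last_before T z \<le> z"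
            using last_before_in[OF assms(1) r0(1) z(1)] last_before_upper[OF r0(1) z(1)]
              last_before_le[OF r0(1) z(1)] by auto
          moreover from this have "dist (last_before T z) x < \<delta>"
            using z r0 by (auto simp: dist_real_def)
          ultimately show ?thesis using \<delta>(2) last_before_self[OF True] by auto
        qed
        then show "\<exists>d>0. \<forall>z. dist z x < d \<longrightarrow>
            dist (f (last_before T z)) (f (last_before T x)) < e"
          using r0(3) by (intro exI[of _ "x - r0"]) auto
      qed
    qed
  qed
  ultimately show ?thesis by (rule borel_measurable_continuous_countable_exceptions)
qed

lemma rd_continuous_step_integrable:
  assumes "closed T" "rd_continuous T f" "\<alpha> \<in> T"
  shows "(\<lambda>x. f (last_before T x)) integrable_on {\<alpha>..\<beta>}"
proof -
  obtain B where B: "\<And>r. r \<in> T \<Longrightarrow> \<alpha> \<le> r \<Longrightarrow> r \<le> \<beta> \<Longrightarrow> \<bar>f r\<bar> \<le> B"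
    using rd_continuous_bounded[OF assms(1,2)] by metis
  show ?thesis
  proof (rule measurable_bounded_by_integrable_imp_integrable_real)
    have "(\<lambda>x. f (last_before T x)) \<in> borel_measurable lborel"
      using rd_continuous_step_measurable[OF assms(1,2)] by simp
    then show "(\<lambda>x. f (last_before T x)) \<in> borel_measurable (lebesgue_on {\<alpha>..\<beta>})"
      by (intro measurable_restrict_space1 measurable_completion)
    show "\<bar>f (last_before T x)\<bar> \<le> B" if "x \<in> {\<alpha>..\<beta>}" for x
      using that last_before_in[OF assms(1,3)] last_before_upper[OF assms(3)]
        last_before_le[OF assms(3)] by (intro B) force+
  qed auto
qed

lemma step_integral_bound:
  assumes "closed T" "rd_continuous T f" "r \<in> T" "t \<in> T" "r \<le> t" "B \<ge> 0"
    and bound: "\<And>z. z \<in> T \<Longrightarrow> r \<le> z \<Longrightarrow> z \<le> t \<Longrightarrow> \<bar>f z - k\<bar> \<le> B"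
  shows "\<bar>integral {r..t} (\<lambda>x. f (last_before T x)) - k * (t - r)\<bar> \<le> B * (t - r)"
proof -
  have "((\<lambda>x. f (last_before T x)) has_integral integral {r..t} (\<lambda>x. f (last_before T x))) {r..t}"
    using rd_continuous_step_integrable[OF assms(1-3)] by (rule integrable_integral)
  moreover have "((\<lambda>x. k) has_integral k * (t - r)) {r..t}"
    using has_integral_const_real[of k r t] assms(5) by (simp add: mult.commute)
  ultimately have "((\<lambda>x. f (last_before T x) - k) has_integral
      integral {r..t} (\<lambda>x. f (last_before T x)) - k * (t - r)) {r..t}"
    by (rule has_integral_diff)
  then have "norm (integral {r..t} (\<lambda>x. f (last_before T x)) - k * (t - r)) \<le> B * measure lborel {r..t}"
  proof (rule has_integral_bound_real[OF assms(6) finite.emptyI])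
    fix x assume "x \<in> {r..t} - {}"
    then show "norm (f (last_before T x) - k) \<le> B"
      using last_before_in[OF assms(1,3)] last_before_upper[OF assms(3)]
        last_before_le[OF assms(3)] unfolding real_norm_def by (intro bound) force+
  qed
  then show ?thesis using assms(5) by simp
qed

text \<open>The antiderivative is the ordinary integral of the step extension.
  Over a gap the extension is constant, which gives the difference quotient at right-scattered points.
  At a right-dense point \<open>f\<close> is continuous, and between \<open>t\<close> and \<open>r\<close> the extension only takes values of
  \<open>f\<close> at points of \<open>T\<close> between \<open>t\<close> and \<open>r\<close>.\<close>

lemma rd_continuous_has_antiderivative:
  assumes "closed T" "rd_continuous T f"
  shows "\<exists>G. delta_antiderivative T f G"
proof (cases "T = {}")
  case True
  then show ?thesis by (simp add: delta_antiderivative_def kappa_def)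
next
  case False
  then obtain c where c: "c \<in> T" by blast
  define F where "F = (\<lambda>x. f (last_before T x))"
  \<comment> \<open>for each \<open>t\<close> one of the two intervals is empty or a point, so this is the signed integral from \<open>c\<close>\<close>
  define G where "G = (\<lambda>t. integral {c..t} F - integral {t..c} F)"
  have int: "F integrable_on {\<alpha>..\<beta>}" if "\<alpha> \<in> T" for \<alpha> \<beta>
    unfolding F_def by (rule rd_continuous_step_integrable[OF assms that])
  have zero: "integral {u..v} F = 0" if "v \<le> u" for u v
    using that by (cases "u = v") auto
  have diff: "G t - G r = integral {r..t} F" if "r \<in> T" "t \<in> T" "r \<le> t" for r t
  proof -
    consider "c \<le> r" | "r < c" "c \<le> t" | "t < c" by linarith
    then show ?thesis
    proof cases
      case 1
      then show ?thesis
        using Henstock_Kurzweil_Integration.integral_combine[OF 1 that(3) int[OF c]] that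
        by (simp add: G_def zero)
    next
      case 2
      then show ?thesis
        using Henstock_Kurzweil_Integration.integral_combine[of r c t F] int[OF that(1)]
        by (simp add: G_def zero)
    next
      case 3
      then show ?thesis
        using Henstock_Kurzweil_Integration.integral_combine[of r t c F] int[OF that(1)] that
        by (simp add: G_def zero)
    qed
  qed
  have est: "\<bar>G t - G r - k * (t - r)\<bar> \<le> B * \<bar>t - r\<bar>"
    if "r \<in> T" "t \<in> T" "B \<ge> 0" "\<And>z. z \<in> T \<Longrightarrow> \<bar>z - t\<bar> \<le> \<bar>r - t\<bar> \<Longrightarrow> \<bar>f z - k\<bar> \<le> B" for r t k B
  proof (cases "r \<le> t")
    case True
    then show ?thesis
      using step_integral_bound[OF assms that(1,2) True that(3), of k] that(4) diff[OF that(1,2) True]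
      by (simp add: F_def)
  next
    case False
    then have le: "t \<le> r" by simp
    have "\<bar>integral {t..r} F - k * (r - t)\<bar> \<le> B * (r - t)"
      unfolding F_def using le by (intro step_integral_bound[OF assms that(2,1) le that(3)] that(4)) auto
    then have "\<bar>G r - G t - k * (r - t)\<bar> \<le> B * \<bar>t - r\<bar>"
      using diff[OF that(2,1) le] le by simp
    moreover have "\<bar>G r - G t - k * (r - t)\<bar> = \<bar>G t - G r - k * (t - r)\<bar>"
      by (simp add: algebra_simps abs_minus_commute)
    ultimately show ?thesis by simp
  qed
  have "has_delta_derivative T G (f t) t" if t: "t \<in> T" for t
  proof (cases "fwd_jump T t = t")
    case True
    then have cont: "continuous (at t within T) f"
      using assms t by (auto simp: rd_continuous_def right_dense_def)
    show ?thesis unfolding has_delta_derivative_def True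
    proof (intro allI impI)
      fix e :: real assume e: "e > 0"
      then obtain \<delta> where \<delta>: "\<delta> > 0" "\<forall>r\<in>T. dist r t < \<delta> \<longrightarrow> dist (f r) (f t) < e"
        using cont unfolding continuous_within_eps_delta by blast
      have "\<bar>G t - G r - f t * (t - r)\<bar> \<le> e * \<bar>t - r\<bar>" if "r \<in> T" "\<bar>r - t\<bar> < \<delta>" for r
      proof (rule est[OF that(1) t])
        fix z assume z: "z \<in> T" "\<bar>z - t\<bar> \<le> \<bar>r - t\<bar>"
        then have "dist z t < \<delta>" using that by (simp add: dist_real_def)
        then show "\<bar>f z - f t\<bar> \<le> e" using \<delta>(2) z by (force simp: dist_real_def)
      qed (use e in simp)
      then show "\<exists>\<delta>>0. \<forall>r\<in>T. \<bar>r - t\<bar> < \<delta> \<longrightarrow> \<bar>G t - G r - f t * (t - r)\<bar> \<le> e * \<bar>t - r\<bar>"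
        using \<delta>(1) by blast
    qed
  next
    case False
    have ge: "t \<le> fwd_jump T t" by (rule fwd_jump_ge[OF t])
    obtain B where B: "B \<ge> 0" "\<And>r. r \<in> T \<Longrightarrow> t - 1 \<le> r \<Longrightarrow> r \<le> t + 1 \<Longrightarrow> \<bar>f r\<bar> \<le> B"
      using rd_continuous_bounded[OF assms] by metis
    have lip: "\<bar>G t - G r\<bar> \<le> B * \<bar>t - r\<bar>" if "r \<in> T" "dist r t < 1" for r
    proof -
      have "\<bar>G t - G r - 0 * (t - r)\<bar> \<le> B * \<bar>t - r\<bar>"
      proof (rule est[OF that(1) t B(1)])
        fix z assume z: "z \<in> T" "\<bar>z - t\<bar> \<le> \<bar>r - t\<bar>"
        then have "\<bar>z - t\<bar> < 1" using that by (simp add: dist_real_def)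
        then show "\<bar>f z - 0\<bar> \<le> B" using B(2)[OF z(1)] by (simp add: abs_less_iff)
      qed
      then show ?thesis by simp
    qed
    have "continuous (at t within T) G" unfolding continuous_within_eps_delta
    proof (intro allI impI)
      fix e :: real assume e: "e > 0"
      define d where "d = min 1 (e / (B + 1))"
      have d: "d > 0" using e B(1) by (simp add: d_def)
      have "dist (G r) (G t) < e" if "r \<in> T" "dist r t < d" for r
      proof -
        have "\<bar>G t - G r\<bar> \<le> B * \<bar>t - r\<bar>" using lip that by (simp add: d_def)
        also have "\<dots> \<le> (B + 1) * \<bar>t - r\<bar>" by (intro mult_right_mono) auto
        also have "\<dots> < (B + 1) * (e / (B + 1))"
          using that B(1) by (intro mult_strict_left_mono) (auto simp: d_def dist_real_def)
        also have "\<dots> = e" using B(1) by simp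
        finally show ?thesis by (simp add: dist_real_def abs_minus_commute)
      qed
      then show "\<exists>d>0. \<forall>r\<in>T. dist r t < d \<longrightarrow> dist (G r) (G t) < e" using d by blast
    qed
    moreover have "G (fwd_jump T t) - G t = f t * (fwd_jump T t - t)"
    proof -
      have "integral {t..fwd_jump T t} F = integral {t..fwd_jump T t} (\<lambda>_. f t)"
      proof (rule integral_spike)
        fix x assume x: "x \<in> {t..fwd_jump T t} - {fwd_jump T t}"
        have "last_before T x = t"
        proof (rule antisym)
          have lb: "last_before T x \<in> T" "last_before T x \<le> x"
            using last_before_in[OF assms(1) t] last_before_le[OF t] x by auto
          then show "last_before T x \<le> t"
            using fwd_jump_le[OF lb(1), of t] x by force
          show "t \<le> last_before T x" using last_before_upper[OF t] x by simp
        qed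
        then show "f t = F x" by (simp add: F_def)
      qed simp
      then show ?thesis using diff[OF t fwd_jump_in[OF assms(1) t] ge] ge by simp
    qed
    ultimately show ?thesis using False by (simp add: has_delta_derivative_iff[OF t])
  qed
  then show ?thesis using kappa_subset[of T] by (auto simp: delta_antiderivative_def)
qed

section \<open>The delta integral\<close>

text \<open>The integral is defined through a chosen antiderivative on all of \<open>T\<close>, so
  it is meaningful exactly when one exists. For this reason every integrand below is shown to be
  rd-continuous on \<open>T\<close>, even where only an interval is of interest.\<close>

lemma delta_integral_antiderivative:
  assumes "closed T" "rd_continuous T f"
  obtains G where "delta_antiderivative T f G"
    "\<And>c d. delta_integral T f c d = G d - G c"
proof -
  have "delta_antiderivative T f (SOME G. delta_antiderivative T f G)"
    using rd_continuous_has_antiderivative[OF assms] by (rule someI_ex)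
  then show ?thesis by (rule that) (simp add: delta_integral_def Let_def)
qed

lemma delta_integral_has_derivative:
  assumes "closed T" "rd_continuous T f"
  shows "delta_antiderivative T f (\<lambda>t. delta_integral T f c t)"
proof -
  obtain G where G: "delta_antiderivative T f G" "\<And>c d. delta_integral T f c d = G d - G c"
    using delta_integral_antiderivative[OF assms] by blast
  show ?thesis unfolding delta_antiderivative_def G(2)
  proof
    fix t assume t: "t \<in> kappa T"
    then have tT: "t \<in> T" using kappa_subset by blast
    have "has_delta_derivative T (\<lambda>t. G t + - G c) (f t + 0) t"
      using G(1) t tT
      by (intro has_delta_derivative_add has_delta_derivative_const) (auto simp: delta_antiderivative_def)
    then show "has_delta_derivative T (\<lambda>t. G t - G c) (f t) t" by simp
  qed
qed

lemma delta_integral_continuous: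
  "closed T \<Longrightarrow> rd_continuous T f \<Longrightarrow> continuous_on T (\<lambda>t. delta_integral T f c t)"
  using antiderivative_continuous delta_integral_has_derivative by blast

lemma delta_integral_refl: "delta_integral T f c c = 0"
  by (simp add: delta_integral_def Let_def)

text \<open>The integral over \<open>{c..d}\<close> can be computed from a function \<open>F\<close> that is an
  antiderivative on this interval only. Solutions of the initial value problem are of this kind.\<close>

lemma delta_integral_eq_local:
  assumes "closed T" "rd_continuous T g" "c \<in> T" "d \<in> T" "c \<le> d"
    and "continuous_on (T \<inter> {c..d}) F"
    and "\<And>r. r \<in> T \<Longrightarrow> c \<le> r \<Longrightarrow> r < d \<Longrightarrow> has_delta_derivative T F (f r) r"
    and "\<And>r. r \<in> T \<Longrightarrow> c \<le> r \<Longrightarrow> r < d \<Longrightarrow> f r = g r"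
  shows "delta_integral T g c d = F d - F c"
proof -
  obtain G where G: "delta_antiderivative T g G" "\<And>c d. delta_integral T g c d = G d - G c"
    using delta_integral_antiderivative[OF assms(1,2)] by blast
  show ?thesis unfolding G(2)
    by (rule antiderivative_shift_unique[OF assms(1,3-5) G(1) assms(6-8), symmetric])
qed

lemma delta_integral_eq:
  assumes "closed T" "rd_continuous T f" "c \<in> T" "d \<in> T" "delta_antiderivative T f F"
  shows "delta_integral T f c d = F d - F c"
proof -
  have *: "delta_integral T f u v = F v - F u" if "u \<in> T" "v \<in> T" "u \<le> v" for u v
  proof (rule delta_integral_eq_local[OF assms(1,2) that])
    show "continuous_on (T \<inter> {u..v}) F"
      using antiderivative_continuous[OF assms(1,5)] by (rule continuous_on_subset) auto
    show "has_delta_derivative T F (f r) r" if "r \<in> T" "u \<le> r" "r < v" for r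
      using assms(5) kappa_if_less[OF that(1) \<open>v \<in> T\<close> that(3)] by (simp add: delta_antiderivative_def)
  qed simp
  have "delta_integral T f d c = - delta_integral T f c d" by (simp add: delta_integral_def Let_def)
  then show ?thesis using *[OF assms(3,4)] *[OF assms(4,3)] by linarith
qed

lemma delta_integral_add:
  assumes "closed T" "rd_continuous T f" "rd_continuous T g" "c \<in> T" "d \<in> T"
  shows "delta_integral T (\<lambda>x. f x + g x) c d = delta_integral T f c d + delta_integral T g c d"
proof -
  have "delta_antiderivative T (\<lambda>x. f x + g x) (\<lambda>t. delta_integral T f c t + delta_integral T g c t)"
    using delta_integral_has_derivative[OF assms(1,2)] delta_integral_has_derivative[OF assms(1,3)] kappa_subset
    unfolding delta_antiderivative_def by (blast intro: has_delta_derivative_add)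
  from delta_integral_eq[OF assms(1) rd_continuous_add[OF assms(2,3)] assms(4,5) this]
  show ?thesis by (simp add: delta_integral_refl)
qed

lemma delta_integral_cmult:
  assumes "closed T" "rd_continuous T f" "c \<in> T" "d \<in> T"
  shows "delta_integral T (\<lambda>x. k * f x) c d = k * delta_integral T f c d"
proof -
  have "delta_antiderivative T (\<lambda>x. k * f x) (\<lambda>t. k * delta_integral T f c t)"
    using delta_integral_has_derivative[OF assms(1,2)] kappa_subset
    unfolding delta_antiderivative_def by (blast intro: has_delta_derivative_cmult)
  from delta_integral_eq[OF assms(1) rd_continuous_mult[OF rd_continuous_const assms(2)] assms(3,4) this]
  show ?thesis by (simp add: delta_integral_refl)
qed

lemma delta_integral_sum:
  assumes "closed T" "\<And>i. i \<in> I \<Longrightarrow> rd_continuous T (f i)" "c \<in> T" "d \<in> T"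
  shows "delta_integral T (\<lambda>x. \<Sum>i\<in>I. f i x) c d = (\<Sum>i\<in>I. delta_integral T (f i) c d)"
  using assms(2)
proof (induction I rule: infinite_finite_induct)
  case (insert i I)
  then show ?case using assms
    by (simp add: delta_integral_add rd_continuous_sum)
next
  case (infinite I)
  then show ?case using delta_integral_cmult[OF assms(1) rd_continuous_const assms(3,4), of 0] by simp
next
  case empty
  then show ?case using delta_integral_cmult[OF assms(1) rd_continuous_const assms(3,4), of 0] by simp
qed

lemma delta_integral_bound:
  assumes "closed T" "rd_continuous T f" "c \<in> T" "d \<in> T" "c \<le> d"
    and "continuous_on (T \<inter> {c..d}) G"
    and "\<And>r. r \<in> T \<Longrightarrow> c \<le> r \<Longrightarrow> r < d \<Longrightarrow> has_delta_derivative T G (g r) r"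
    and "\<And>r. r \<in> T \<Longrightarrow> c \<le> r \<Longrightarrow> r < d \<Longrightarrow> \<bar>f r\<bar> \<le> g r"
  shows "\<bar>delta_integral T f c d\<bar> \<le> G d - G c"
proof -
  have "\<bar>delta_integral T f c d - delta_integral T f c c\<bar> \<le> G d - G c"
  proof (rule delta_derivative_comparison[OF assms(1,3-5) _ assms(6) _ assms(7,8)])
    show "continuous_on (T \<inter> {c..d}) (\<lambda>t. delta_integral T f c t)"
      using delta_integral_continuous[OF assms(1,2)] by (rule continuous_on_subset) auto
    show "has_delta_derivative T (\<lambda>t. delta_integral T f c t) (f r) r"
      if "r \<in> T" "c \<le> r" "r < d" for r
      using delta_integral_has_derivative[OF assms(1,2)] kappa_if_less[OF that(1) assms(4) that(3)]
      by (simp add: delta_antiderivative_def)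
  qed
  then show ?thesis by (simp add: delta_integral_refl)
qed

text \<open>This backward integral over a gap produces the signs in the case where the
  evaluation point precedes the initial point.\<close>

lemma delta_integral_jump:
  assumes "closed T" "rd_continuous T f" "s \<in> kappa T"
  shows "delta_integral T f (fwd_jump T s) s = - (fwd_jump T s - s) * f s"
proof -
  have s: "s \<in> T" using assms(3) kappa_subset by blast
  have "has_delta_derivative T (\<lambda>t. delta_integral T f (fwd_jump T s) t) (f s) s"
    using delta_integral_has_derivative[OF assms(1,2)] assms(3) by (simp add: delta_antiderivative_def)
  from has_delta_derivative_scattered[OF this s] show ?thesis
    by (simp add: delta_integral_refl algebra_simps)
qed

lemma has_delta_derivative_cong:
  assumes "closed T" "t \<in> T" "has_delta_derivative T f l t" "\<And>r. r \<in> T \<Longrightarrow> f r = g r"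
  shows "has_delta_derivative T g l t"
proof -
  have "f (fwd_jump T t) = g (fwd_jump T t)" using assms(4) fwd_jump_in[OF assms(1,2)] by blast
  then show ?thesis using assms(3,4) unfolding has_delta_derivative_def by simp
qed

lemma rd_continuous_cong:
  assumes "rd_continuous T f" "\<And>r. r \<in> T \<Longrightarrow> f r = g r"
  shows "rd_continuous T g"
proof -
  have "(f \<longlongrightarrow> L) (at t within S) \<longleftrightarrow> (g \<longlongrightarrow> L) (at t within S)" if "S \<subseteq> T" for S t L
    by (rule Lim_cong_within) (use that assms(2) in auto)
  then show ?thesis using assms unfolding rd_continuous_def continuous_within
    by (metis Int_lower1 order_refl)
qed

section \<open>Generalized monomials as kernels of iterated integration\<close>

text \<open>The \<open>k\<close>-fold antiderivative of a function with all initial values at \<open>c\<close> equal to zero.\<close>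

definition iterated_integral :: "real set \<Rightarrow> real \<Rightarrow> nat \<Rightarrow> (real \<Rightarrow> real) \<Rightarrow> real \<Rightarrow> real" where
  "iterated_integral T c k = ((\<lambda>f t. delta_integral T f c t) ^^ k)"

lemma iterated_integral_0 [simp]: "iterated_integral T c 0 f = f"
  by (simp add: iterated_integral_def)

lemma iterated_integral_Suc:
  "iterated_integral T c (Suc k) f t = delta_integral T (iterated_integral T c k f) c t"
  by (simp add: iterated_integral_def)

lemma gen_monomial_eq_iterated_integral:
  "gen_monomial T k t c = iterated_integral T c k (\<lambda>_. 1) t"
proof -
  have "(\<lambda>t. gen_monomial T k t c) = iterated_integral T c k (\<lambda>_. 1)"
    by (induction k) (auto simp: iterated_integral_Suc)
  then show ?thesis by (rule fun_cong)
qed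

lemma rd_continuous_iterated_integral:
  assumes "closed T" "rd_continuous T f"
  shows "rd_continuous T (iterated_integral T c k f)"
proof (induction k)
  case (Suc k)
  have "iterated_integral T c (Suc k) f = (\<lambda>t. delta_integral T (iterated_integral T c k f) c t)"
    by (rule ext) (rule iterated_integral_Suc)
  then show ?case
    using rd_continuous_if_continuous[OF delta_integral_continuous[OF assms(1) Suc]] by simp
qed (simp add: assms)

lemma rd_continuous_gen_monomial:
  "closed T \<Longrightarrow> rd_continuous T (\<lambda>t. gen_monomial T k t c)"
  unfolding gen_monomial_eq_iterated_integral
  by (intro rd_continuous_iterated_integral rd_continuous_const)

lemma iterated_integral_has_derivative:
  assumes "closed T" "rd_continuous T f" "t \<in> kappa T"
  shows "has_delta_derivative T (iterated_integral T c (Suc k) f) (iterated_integral T c k f t) t"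
proof -
  have "iterated_integral T c (Suc k) f = (\<lambda>t. delta_integral T (iterated_integral T c k f) c t)"
    by (rule ext) (rule iterated_integral_Suc)
  then show ?thesis
    using delta_integral_has_derivative[OF assms(1) rd_continuous_iterated_integral[OF assms(1,2)]] assms(3)
    by (simp add: delta_antiderivative_def)
qed

lemma iterated_integral_base: "k > 0 \<Longrightarrow> iterated_integral T c k f c = 0"
  by (cases k) (simp_all add: iterated_integral_Suc delta_integral_refl)

text \<open>The two statements feed each other in an induction on \<open>k\<close>. For the integral,
  the function \<open>W(\<eta>) = (\<Sum>j\<le>k. h\<^sub>j(t,\<eta>) F\<^sub>j(\<eta>))\<close>, where \<open>F\<^sub>j\<close> is the \<open>(k+1-j)\<close>-fold integral of \<open>f\<close>,
  has the derivative \<open>h\<^sub>k(t,\<sigma>(\<eta>)) f(\<eta>)\<close>: by the product rule and the derivatives of the \<open>h\<^sub>j\<close> in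
  the second argument for \<open>j \<le> k\<close>, everything else telescopes. It vanishes at \<open>c\<close>, and at \<open>t\<close> only
  the term \<open>j = 0\<close> is left. The derivative of \<open>h\<^sub>k\<^sub>+\<^sub>1\<close> in the second argument is the case \<open>f = 1\<close> of the
  integral formula, because it writes \<open>h\<^sub>k\<^sub>+\<^sub>1(t,\<eta>)\<close> as an integral from \<open>\<eta>\<close> to \<open>t\<close> whose integrand
  does not depend on \<open>\<eta>\<close>.\<close>

lemma gen_monomial_second_argument:
  assumes "closed T"
  shows "t \<in> T \<Longrightarrow> delta_antiderivative T (\<lambda>\<eta>. - gen_monomial T k t (fwd_jump T \<eta>)) (gen_monomial T (Suc k) t)"
    and "c \<in> T \<Longrightarrow> t \<in> T \<Longrightarrow> rd_continuous T f \<Longrightarrow>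
      delta_integral T (\<lambda>\<eta>. gen_monomial T k t (fwd_jump T \<eta>) * f \<eta>) c t = iterated_integral T c (Suc k) f t"
proof (induction k arbitrary: c t f rule: less_induct)
  case (less k)
  let ?\<sigma> = "fwd_jump T"
  have rd: "rd_continuous T (\<lambda>\<eta>. gen_monomial T k t (?\<sigma> \<eta>))" if t: "t \<in> T" for t
  proof (cases k)
    case 0
    then show ?thesis by (simp add: rd_continuous_const)
  next
    case (Suc i)
    have "continuous_on T (gen_monomial T (Suc i) t)"
      by (rule antiderivative_continuous[OF assms less.IH(1)]) (use Suc t in auto)
    then show ?thesis unfolding Suc by (rule rd_continuous_fwd_jump[OF assms])
  qed
  have integral: "delta_integral T (\<lambda>\<eta>. gen_monomial T k t (?\<sigma> \<eta>) * f \<eta>) c t = iterated_integral T c (Suc k) f t"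
    if c: "c \<in> T" and t: "t \<in> T" and f: "rd_continuous T f" for c t f
  proof -
    let ?J = "\<lambda>j. iterated_integral T c j f"
    \<comment> \<open>the term \<open>j = 0\<close> is written separately because \<open>h\<^sub>0\<close> is constant\<close>
    define W where "W = (\<lambda>\<eta>. ?J (Suc k) \<eta> + (\<Sum>i<k. gen_monomial T (Suc i) t \<eta> * ?J (k - i) \<eta>))"
    have "delta_antiderivative T (\<lambda>\<eta>. gen_monomial T k t (?\<sigma> \<eta>) * f \<eta>) W"
      unfolding delta_antiderivative_def
    proof
      fix \<eta> assume \<eta>: "\<eta> \<in> kappa T"
      then have \<eta>T: "\<eta> \<in> T" using kappa_subset by blast
      \<comment> \<open>the two terms of the product rule are \<open>A (Suc i)\<close> and \<open>- A i\<close>\<close>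
      define A where "A = (\<lambda>j. gen_monomial T j t (?\<sigma> \<eta>) * ?J (k - j) \<eta>)"
      have "has_delta_derivative T W (?J k \<eta> + (\<Sum>i<k. A (Suc i) - A i)) \<eta>"
        unfolding W_def
      proof (intro has_delta_derivative_add[OF \<eta>T] has_delta_derivative_sum[OF \<eta>T]
          iterated_integral_has_derivative[OF assms f \<eta>])
        fix i assume "i \<in> {..<k}"
        then have i: "i < k" "k - i = Suc (k - Suc i)" by auto
        have "has_delta_derivative T (gen_monomial T (Suc i) t) (- gen_monomial T i t (?\<sigma> \<eta>)) \<eta>"
          using less.IH(1)[OF i(1) t] \<eta> unfolding delta_antiderivative_def by blast
        moreover have "has_delta_derivative T (?J (k - i)) (?J (k - Suc i) \<eta>) \<eta>"
          unfolding i(2) by (rule iterated_integral_has_derivative[OF assms f \<eta>])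
        ultimately have "has_delta_derivative T (\<lambda>\<eta>. gen_monomial T (Suc i) t \<eta> * ?J (k - i) \<eta>)
          (- gen_monomial T i t (?\<sigma> \<eta>) * ?J (k - i) \<eta> + gen_monomial T (Suc i) t (?\<sigma> \<eta>) * ?J (k - Suc i) \<eta>) \<eta>"
          by (rule has_delta_derivative_mult[OF \<eta>T])
        then show "has_delta_derivative T (\<lambda>\<eta>. gen_monomial T (Suc i) t \<eta> * ?J (k - i) \<eta>) (A (Suc i) - A i) \<eta>"
          by (simp add: A_def del: gen_monomial.simps)
      qed
      also have "(\<Sum>i<k. A (Suc i) - A i) = A k - A 0" by (rule sum_lessThan_telescope)
      also have "?J k \<eta> + (A k - A 0) = gen_monomial T k t (?\<sigma> \<eta>) * f \<eta>" by (simp add: A_def)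
      finally show "has_delta_derivative T W (gen_monomial T k t (?\<sigma> \<eta>) * f \<eta>) \<eta>" .
    qed
    then have "delta_integral T (\<lambda>\<eta>. gen_monomial T k t (?\<sigma> \<eta>) * f \<eta>) c t = W t - W c"
      by (rule delta_integral_eq[OF assms rd_continuous_mult[OF rd[OF t] f] c t])
    also have "W c = 0" by (simp add: W_def iterated_integral_base)
    also have "W t = ?J (Suc k) t" by (simp add: W_def delta_integral_refl)
    finally show ?thesis by simp
  qed
  {
    case 1
    obtain G where G: "delta_antiderivative T (\<lambda>\<eta>. gen_monomial T k t (?\<sigma> \<eta>)) G"
      "\<And>c d. delta_integral T (\<lambda>\<eta>. gen_monomial T k t (?\<sigma> \<eta>)) c d = G d - G c"
      using delta_integral_antiderivative[OF assms rd[OF 1]] by blast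
    have mono: "G t + (-1) * G \<eta> = gen_monomial T (Suc k) t \<eta>" if "\<eta> \<in> T" for \<eta>
      using integral[OF that 1 rd_continuous_const[of T 1]] G(2)[of \<eta> t]
      by (simp add: gen_monomial_eq_iterated_integral del: gen_monomial.simps)
    show ?case unfolding delta_antiderivative_def
    proof
      fix \<eta> assume \<eta>: "\<eta> \<in> kappa T"
      then have \<eta>T: "\<eta> \<in> T" using kappa_subset by blast
      have "has_delta_derivative T (\<lambda>\<eta>. G t + (-1) * G \<eta>) (0 + (-1) * gen_monomial T k t (?\<sigma> \<eta>)) \<eta>"
        using G(1) \<eta> \<eta>T unfolding delta_antiderivative_def
        by (intro has_delta_derivative_add has_delta_derivative_const has_delta_derivative_cmult) auto
      from has_delta_derivative_cong[OF assms \<eta>T this mono]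
      show "has_delta_derivative T (gen_monomial T (Suc k) t) (- gen_monomial T k t (?\<sigma> \<eta>)) \<eta>"
        by simp
    qed
  next
    case 2
    then show ?case by (rule integral)
  }
qed

lemma rd_continuous_gen_monomial_fwd_jump:
  assumes "closed T" "t \<in> T"
  shows "rd_continuous T (\<lambda>\<eta>. gen_monomial T k t (fwd_jump T \<eta>))"
proof (cases k)
  case 0
  then show ?thesis by (simp add: rd_continuous_const)
next
  case (Suc i)
  show ?thesis unfolding Suc
    by (rule rd_continuous_fwd_jump[OF assms(1) antiderivative_continuous[OF assms(1)
          gen_monomial_second_argument(1)[OF assms]]])
qed

lemma gen_monomial_bound:
  assumes "closed T" "c \<in> T" "t \<in> T" "c \<le> t" "t \<le> d"
  shows "\<bar>gen_monomial T k t c\<bar> \<le> (d - c) ^ k"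
  using assms(3-5)
proof (induction k arbitrary: t)
  case (Suc k)
  have id: "has_delta_derivative T (\<lambda>x. x) 1 r" if "r \<in> T" for r
    using that by (auto simp: has_delta_derivative_iff)
  have "\<bar>delta_integral T (\<lambda>\<eta>. gen_monomial T k \<eta> c) c t\<bar> \<le> (d - c) ^ k * t - (d - c) ^ k * c"
  proof (rule delta_integral_bound[OF assms(1) rd_continuous_gen_monomial[OF assms(1)] assms(2) Suc.prems(1,2)])
    show "has_delta_derivative T (\<lambda>x. (d - c) ^ k * x) ((d - c) ^ k * 1) r" if "r \<in> T" for r
      by (intro has_delta_derivative_cmult id that)
  qed (use Suc in \<open>auto intro!: continuous_intros\<close>)
  also have "\<dots> = (d - c) ^ k * (t - c)" by (simp add: algebra_simps)
  also have "\<dots> \<le> (d - c) ^ k * (d - c)" using Suc.prems by (intro mult_left_mono) auto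
  finally show ?case by (simp add: mult.commute)
qed simp

text \<open>Taylor's formula for a chain \<open>v 0, \<dots>, v n\<close> in which each function is the
  derivative of the one before, with initial values \<open>0, \<dots>, 0, 1\<close> at \<open>c\<close>: integrate downwards from
  \<open>v n\<close>. The function \<open>g\<close> replaces \<open>v n\<close>, which need not be rd-continuous outside the
  interval.\<close>

lemma delta_taylor_unit_impulse:
  assumes "closed T" "c \<in> T" "t \<in> T" "c \<le> t" "rd_continuous T g"
    and cont: "\<And>i. i < n \<Longrightarrow> continuous_on (T \<inter> {c..t}) (v i)"
    and der: "\<And>i r. i < n \<Longrightarrow> r \<in> T \<Longrightarrow> c \<le> r \<Longrightarrow> r < t \<Longrightarrow> has_delta_derivative T (v i) (v (Suc i) r) r"
    and top: "\<And>r. r \<in> T \<Longrightarrow> c \<le> r \<Longrightarrow> r < t \<Longrightarrow> v n r = g r"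
    and init: "\<And>i. i < n \<Longrightarrow> v i c = (if i = n - 1 then 1 else 0)"
    and "j < n" "r \<in> T" "c \<le> r" "r \<le> t"
  shows "v (n - Suc j) r = gen_monomial T j r c + iterated_integral T c (Suc j) g r"
  using assms(10-13)
proof (induction j arbitrary: r)
  case 0
  have "delta_integral T g c r = v (n - 1) r - v (n - 1) c"
  proof (rule delta_integral_eq_local[OF assms(1,5,2) 0(2,3)])
    show "continuous_on (T \<inter> {c..r}) (v (n - 1))"
      using cont[of "n - 1"] 0 by (auto elim!: continuous_on_subset)
    show "has_delta_derivative T (v (n - 1)) (v n x) x" if "x \<in> T" "c \<le> x" "x < r" for x
      using der[of "n - 1" x] that 0 by simp
    show "v n x = g x" if "x \<in> T" "c \<le> x" "x < r" for x using top that 0 by simp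
  qed
  then show ?case using init[of "n - 1"] 0 by (simp add: iterated_integral_Suc)
next
  case (Suc j)
  define i where "i = n - Suc (Suc j)"
  have i: "i < n" "Suc i = n - Suc j" "i \<noteq> n - 1" using Suc.prems(1) by (auto simp: i_def)
  let ?f = "\<lambda>x. gen_monomial T j x c + iterated_integral T c (Suc j) g x"
  have rd: "rd_continuous T (\<lambda>x. gen_monomial T j x c)" "rd_continuous T (iterated_integral T c (Suc j) g)"
    using rd_continuous_gen_monomial rd_continuous_iterated_integral assms by blast+
  have "delta_integral T ?f c r = v i r - v i c"
  proof (rule delta_integral_eq_local[OF assms(1) rd_continuous_add[OF rd] assms(2) Suc.prems(2,3)])
    show "continuous_on (T \<inter> {c..r}) (v i)"
      using cont[OF i(1)] Suc.prems by (auto elim!: continuous_on_subset)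
    show "has_delta_derivative T (v i) (v (Suc i) x) x" if "x \<in> T" "c \<le> x" "x < r" for x
      using der[OF i(1)] that Suc.prems by simp
    show "v (Suc i) x = ?f x" if "x \<in> T" "c \<le> x" "x < r" for x
      unfolding i(2) using that Suc.prems by (intro Suc.IH) auto
  qed
  then show ?case
    using init[OF i(1)] i(3) delta_integral_add[OF assms(1) rd assms(2) Suc.prems(2)]
    by (simp add: iterated_integral_Suc[of T c "Suc j"] i_def)
qed

section \<open>Convergence of the Neumann series\<close>

text \<open>Over a gap the inequality is \<open>1 + x \<le> exp x\<close>.\<close>

lemma delta_derivative_exp:
  assumes "t \<in> T" "L \<ge> 0"
  obtains g where "has_delta_derivative T (\<lambda>x. exp (L * (x - c))) g t" "L * exp (L * (t - c)) \<le> g"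
proof (cases "fwd_jump T t = t")
  case True
  have "((\<lambda>x. exp (L * (x - c))) has_real_derivative L * exp (L * (t - c))) (at t within T)"
    by (auto intro!: derivative_eq_intros)
  then have "has_delta_derivative T (\<lambda>x. exp (L * (x - c))) (L * exp (L * (t - c))) t"
    using True DERIV_continuous by (auto simp: has_delta_derivative_iff[OF assms(1)])
  then show ?thesis by (rule that) simp
next
  case False
  define m where "m = fwd_jump T t - t"
  have m: "m > 0" using fwd_jump_ge[OF assms(1)] False by (simp add: m_def)
  define g where "g = (exp (L * (fwd_jump T t - c)) - exp (L * (t - c))) / m"
  show ?thesis
  proof (rule that)
    show "has_delta_derivative T (\<lambda>x. exp (L * (x - c))) g t"
      using m False unfolding has_delta_derivative_iff[OF assms(1)]
      by (auto simp: g_def m_def intro!: continuous_intros)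
    have "exp (L * (fwd_jump T t - c)) = exp (L * (t - c)) * exp (L * m)"
      by (simp add: m_def exp_add[symmetric] algebra_simps)
    also have "\<dots> \<ge> exp (L * (t - c)) * (1 + L * m)"
      by (intro mult_left_mono exp_ge_add_one_self) auto
    finally show "L * exp (L * (t - c)) \<le> g"
      using m by (simp add: g_def field_simps)
  qed
qed

text \<open>The difference \<open>D m\<close> between \<open>\<phi>\<close> and the sum of \<open>m\<close> terms satisfies
  \<open>D (m + 1) = lam V (D m)\<close>, where \<open>V\<close> is the integral operator with kernel \<open>K\<close>. In the norm
  weighted by \<open>exp (L (x - c))\<close> the operator \<open>V\<close> has norm at most \<open>M / L\<close>, since integration of the
  weight gains a factor \<open>1 / L\<close>. For the large \<open>L\<close> chosen here each step halves the remainder, so the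
  partial sums converge to \<open>\<phi>\<close>.\<close>

lemma neumann_series_sums:
  fixes k :: "nat \<Rightarrow> real \<Rightarrow> real" and lam :: real
  assumes "closed T" "c \<in> T" "t \<in> T" "c \<le> t" "rd_continuous T \<phi>"
    and k: "\<And>m. rd_continuous T (k m)"
    and K: "\<And>r. r \<in> T \<Longrightarrow> rd_continuous T (K r)"
    and M: "\<And>r \<eta>. r \<in> T \<Longrightarrow> \<eta> \<in> T \<Longrightarrow> c \<le> \<eta> \<Longrightarrow> \<eta> < r \<Longrightarrow> r \<le> t \<Longrightarrow> \<bar>K r \<eta>\<bar> \<le> M"
    and M0: "M \<ge> 0"
    and volterra: "\<And>r. r \<in> T \<Longrightarrow> c \<le> r \<Longrightarrow> r \<le> t \<Longrightarrow>
      \<phi> r = k 0 r + lam * delta_integral T (\<lambda>\<eta>. K r \<eta> * \<phi> \<eta>) c r"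
    and step: "\<And>m r. r \<in> T \<Longrightarrow> k (Suc m) r = delta_integral T (\<lambda>\<eta>. K r \<eta> * k m \<eta>) c r"
  shows "(\<lambda>l. k l t * lam ^ l) sums \<phi> t"
proof -
  define D where "D = (\<lambda>m r. \<phi> r + (- 1) * (\<Sum>l<m. lam ^ l * k l r))"
  have D_Suc: "D (Suc m) r = D m r + (- (lam ^ m)) * k m r" for m r
    by (simp add: D_def)
  have D_rd: "rd_continuous T (D m)" for m
    unfolding D_def
    by (intro rd_continuous_add rd_continuous_mult rd_continuous_const rd_continuous_sum k assms)
  have D_rec: "D (Suc m) r = lam * delta_integral T (\<lambda>\<eta>. K r \<eta> * D m \<eta>) c r"
    if r: "r \<in> T" "c \<le> r" "r \<le> t" for m r
  proof (induction m)
    case 0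
    then show ?case using volterra[OF r] by (simp add: D_def)
  next
    case (Suc m)
    have rd: "rd_continuous T (\<lambda>\<eta>. K r \<eta> * D m \<eta>)" "rd_continuous T (\<lambda>\<eta>. K r \<eta> * k m \<eta>)"
      using rd_continuous_mult K[OF r(1)] D_rd k by blast+
    have eq: "(\<lambda>\<eta>. K r \<eta> * D (Suc m) \<eta>) = (\<lambda>\<eta>. K r \<eta> * D m \<eta> + (- (lam ^ m)) * (K r \<eta> * k m \<eta>))"
      unfolding D_Suc by (simp add: algebra_simps)
    have "delta_integral T (\<lambda>\<eta>. K r \<eta> * D (Suc m) \<eta>) c r =
        delta_integral T (\<lambda>\<eta>. K r \<eta> * D m \<eta>) c r +
        delta_integral T (\<lambda>\<eta>. (- (lam ^ m)) * (K r \<eta> * k m \<eta>)) c r"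
      unfolding eq
      by (rule delta_integral_add[OF assms(1) rd(1) rd_continuous_mult[OF rd_continuous_const rd(2)] assms(2) r(1)])
    also have "delta_integral T (\<lambda>\<eta>. (- (lam ^ m)) * (K r \<eta> * k m \<eta>)) c r = - (lam ^ m) * k (Suc m) r"
      unfolding step[OF r(1)] by (rule delta_integral_cmult[OF assms(1) rd(2) assms(2) r(1)])
    finally have rec: "delta_integral T (\<lambda>\<eta>. K r \<eta> * D (Suc m) \<eta>) c r =
        delta_integral T (\<lambda>\<eta>. K r \<eta> * D m \<eta>) c r + - (lam ^ m) * k (Suc m) r" .
    show ?case unfolding rec D_Suc[of "Suc m"] Suc by (simp add: algebra_simps)
  qed
  obtain B where B: "B \<ge> 0" "\<And>r. r \<in> T \<Longrightarrow> c \<le> r \<Longrightarrow> r \<le> t \<Longrightarrow> \<bar>\<phi> r\<bar> \<le> B"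
    using rd_continuous_bounded[OF assms(1,5)] by metis
  \<comment> \<open>so that \<open>\<bar>lam\<bar> * M / L \<le> 1 / 2\<close>; the summand \<open>1\<close> keeps \<open>L\<close> positive\<close>
  define L where "L = 2 * \<bar>lam\<bar> * M + 1"
  have L: "L > 0" "\<bar>lam\<bar> * M / L \<le> 1 / 2" using M0 by (auto simp: L_def add_pos_nonneg field_simps)
  define E where "E = (\<lambda>x. exp (L * (x - c)))"
  have bound: "\<bar>D m r\<bar> \<le> B * (1/2) ^ m * E r" if "r \<in> T" "c \<le> r" "r \<le> t" for m r
    using that
  proof (induction m arbitrary: r)
    case 0
    have "1 \<le> E r" using 0 L by (simp add: E_def)
    then have "B * 1 \<le> B * E r" using B(1) by (intro mult_left_mono) auto
    then show ?case using B(2)[OF 0] by (simp add: D_def)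
  next
    case (Suc m)
    have "\<exists>g. has_delta_derivative T E g x \<and> L * E x \<le> g" if "x \<in> T" for x
      unfolding E_def using delta_derivative_exp[OF that, of L c] L(1) by (metis less_imp_le)
    then obtain g where g: "\<And>x. x \<in> T \<Longrightarrow> has_delta_derivative T E (g x) x"
      "\<And>x. x \<in> T \<Longrightarrow> L * E x \<le> g x" by metis
    define C where "C = M * (B * (1/2) ^ m) / L"
    have C: "C \<ge> 0" using M0 B(1) L(1) by (simp add: C_def)
    have "\<bar>delta_integral T (\<lambda>\<eta>. K r \<eta> * D m \<eta>) c r\<bar> \<le> C * E r - C * E c"
    proof (rule delta_integral_bound[OF assms(1) _ assms(2) Suc.prems(1,2)])
      show "rd_continuous T (\<lambda>\<eta>. K r \<eta> * D m \<eta>)"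
        using rd_continuous_mult K[OF Suc.prems(1)] D_rd by blast
      show "continuous_on (T \<inter> {c..r}) (\<lambda>x. C * E x)"
        unfolding E_def by (intro continuous_intros)
      show "has_delta_derivative T (\<lambda>x. C * E x) (C * g x) x" if "x \<in> T" for x
        by (intro has_delta_derivative_cmult g that)
      show "\<bar>K r x * D m x\<bar> \<le> C * g x" if x: "x \<in> T" "c \<le> x" "x < r" for x
      proof -
        have "\<bar>K r x * D m x\<bar> \<le> M * (B * (1/2) ^ m * E x)"
          unfolding abs_mult using M0 x Suc.prems by (intro mult_mono M Suc.IH) auto
        also have "\<dots> = C * (L * E x)" using L(1) by (simp add: C_def)
        also have "\<dots> \<le> C * g x" using C g(2)[OF x(1)] by (intro mult_left_mono) auto
        finally show ?thesis .
      qed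
    qed
    also have "\<dots> \<le> C * E r" using C by (simp add: E_def)
    finally have "\<bar>D (Suc m) r\<bar> \<le> \<bar>lam\<bar> * (C * E r)"
      unfolding D_rec[OF Suc.prems] abs_mult by (intro mult_left_mono) auto
    also have "\<dots> = (\<bar>lam\<bar> * M / L) * (B * (1/2) ^ m * E r)" by (simp add: C_def)
    also have "\<dots> \<le> 1 / 2 * (B * (1/2) ^ m * E r)"
      using L(2) B(1) by (intro mult_right_mono) (auto simp: E_def)
    finally show ?case by simp
  qed
  have "(\<lambda>m. B * E t * (1/2) ^ m) \<longlonglongrightarrow> B * E t * 0"
    by (intro tendsto_mult tendsto_const LIMSEQ_power_zero) auto
  then have lim: "(\<lambda>m. B * E t * (1/2) ^ m) \<longlonglongrightarrow> 0" by simp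
  have "(\<lambda>m. D m t) \<longlonglongrightarrow> 0"
    by (rule Lim_null_comparison[OF _ lim])
       (use bound[OF assms(3,4) order_refl] in \<open>simp add: mult_ac\<close>)
  then have "(\<lambda>m. \<phi> t - D m t) \<longlonglongrightarrow> \<phi> t - 0" by (intro tendsto_diff tendsto_const)
  then show ?thesis unfolding sums_def D_def by (simp add: mult.commute)
qed

section \<open>The kernel of the linear equation\<close>

definition monomial_kernel :: "real set \<Rightarrow> nat \<Rightarrow> (nat \<Rightarrow> real \<Rightarrow> real) \<Rightarrow> real \<Rightarrow> real \<Rightarrow> real" where
  "monomial_kernel T n p = (\<lambda>t s. \<Sum>i = 0..n-1. p (n - i) t * gen_monomial T (n - i - 1) t (fwd_jump T s))"

lemma rd_continuous_monomial_kernel_right: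
  assumes "closed T" "r \<in> T"
  shows "rd_continuous T (monomial_kernel T n p r)"
  unfolding monomial_kernel_def
  by (intro rd_continuous_sum rd_continuous_mult rd_continuous_const
      rd_continuous_gen_monomial_fwd_jump assms)

lemma rd_continuous_monomial_kernel_left:
  assumes "closed T" "n \<ge> 1" "\<forall>i\<in>{1..n}. rd_continuous T (p i)"
  shows "rd_continuous T (\<lambda>r. monomial_kernel T n p r s)"
  unfolding monomial_kernel_def
  by (intro rd_continuous_sum rd_continuous_mult rd_continuous_gen_monomial assms(1) bspec[OF assms(3)])
     (use assms(2) in auto)

text \<open>Integration against the kernel combines iterated integrals, since the
  monomials in the kernel are the kernels of iterated integration.\<close>

lemma monomial_kernel_integral:
  assumes "closed T" "n \<ge> 1" "rd_continuous T f" "c \<in> T" "r \<in> T"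
  shows "delta_integral T (\<lambda>\<eta>. monomial_kernel T n p r \<eta> * f \<eta>) c r =
    (\<Sum>i = 0..n-1. p (n - i) r * iterated_integral T c (n - i) f r)"
proof -
  have rd: "rd_continuous T (\<lambda>\<eta>. gen_monomial T k r (fwd_jump T \<eta>) * f \<eta>)" for k
    by (intro rd_continuous_mult rd_continuous_gen_monomial_fwd_jump assms)
  have "(\<lambda>\<eta>. monomial_kernel T n p r \<eta> * f \<eta>) =
      (\<lambda>\<eta>. \<Sum>i = 0..n-1. p (n - i) r * (gen_monomial T (n - i - 1) r (fwd_jump T \<eta>) * f \<eta>))"
    by (simp add: monomial_kernel_def sum_distrib_right mult.assoc)
  then have "delta_integral T (\<lambda>\<eta>. monomial_kernel T n p r \<eta> * f \<eta>) c r =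
      (\<Sum>i = 0..n-1. delta_integral T (\<lambda>\<eta>. p (n - i) r * (gen_monomial T (n - i - 1) r (fwd_jump T \<eta>) * f \<eta>)) c r)"
    using delta_integral_sum[OF assms(1) rd_continuous_mult[OF rd_continuous_const rd] assms(4,5)] by simp
  also have "\<dots> = (\<Sum>i = 0..n-1. p (n - i) r * iterated_integral T c (n - i) f r)"
  proof (rule sum.cong[OF refl])
    fix i assume "i \<in> {0..n-1}"
    then have "Suc (n - i - 1) = n - i" using assms(2) by auto
    then show "delta_integral T (\<lambda>\<eta>. p (n - i) r * (gen_monomial T (n - i - 1) r (fwd_jump T \<eta>) * f \<eta>)) c r =
        p (n - i) r * iterated_integral T c (n - i) f r"
      using delta_integral_cmult[OF assms(1) rd assms(4,5)]
        gen_monomial_second_argument(2)[OF assms(1,4,5,3), of "n - i - 1"] by simp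
  qed
  finally show ?thesis .
qed

text \<open>Each step of the iteration is, by the formula above, a combination of
  iterated integrals with coefficients \<open>p i\<close>. In particular the iterated kernels are defined by
  integrals that exist.\<close>

lemma rd_continuous_iterated_kernel:
  assumes "closed T" "n \<ge> 1" "\<forall>i\<in>{1..n}. rd_continuous T (p i)" "s \<in> T"
  shows "rd_continuous T (\<lambda>r. iterated_kernel T (monomial_kernel T n p) m r s)"
proof (induction m)
  case 0
  then show ?case using rd_continuous_monomial_kernel_left[OF assms(1-3)] by simp
next
  case (Suc m)
  let ?f = "\<lambda>r. iterated_kernel T (monomial_kernel T n p) m r s"
  have "rd_continuous T (\<lambda>r. \<Sum>i = 0..n-1. p (n - i) r * iterated_integral T (fwd_jump T s) (n - i) ?f r)"
    by (intro rd_continuous_sum rd_continuous_mult rd_continuous_iterated_integral assms(1) Suc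
        bspec[OF assms(3)]) (use assms(2) in auto)
  then show ?case
    by (rule rd_continuous_cong)
       (simp add: monomial_kernel_integral[OF assms(1,2) Suc fwd_jump_in[OF assms(1,4)]])
qed

lemma monomial_kernel_bounded:
  assumes "closed T" "n \<ge> 1" "\<forall>i\<in>{1..n}. rd_continuous T (p i)"
  obtains M where "M \<ge> 0" "\<And>r \<eta>. r \<in> T \<Longrightarrow> \<eta> \<in> T \<Longrightarrow> c \<le> \<eta> \<Longrightarrow> \<eta> < r \<Longrightarrow> r \<le> t \<Longrightarrow> \<bar>monomial_kernel T n p r \<eta>\<bar> \<le> M"
proof -
  have "\<exists>P. P \<ge> 0 \<and> (\<forall>r\<in>T. c \<le> r \<longrightarrow> r \<le> t \<longrightarrow> \<bar>p i r\<bar> \<le> P)" if "i \<in> {1..n}" for i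
    using rd_continuous_bounded[OF assms(1) bspec[OF assms(3) that], of c t] by metis
  then obtain P where P: "\<And>i. i \<in> {1..n} \<Longrightarrow> P i \<ge> 0"
    "\<And>i r. i \<in> {1..n} \<Longrightarrow> r \<in> T \<Longrightarrow> c \<le> r \<Longrightarrow> r \<le> t \<Longrightarrow> \<bar>p i r\<bar> \<le> P i" by metis
  define M where "M = (\<Sum>i = 0..n-1. P (n - i) * \<bar>t - c\<bar> ^ (n - i - 1))"
  show ?thesis
  proof (rule that)
    show "M \<ge> 0" unfolding M_def using assms(2) by (intro sum_nonneg mult_nonneg_nonneg P) auto
    fix r \<eta> assume a: "r \<in> T" "\<eta> \<in> T" "c \<le> \<eta>" "\<eta> < r" "r \<le> t"
    have j: "fwd_jump T \<eta> \<in> T" "\<eta> \<le> fwd_jump T \<eta>" "fwd_jump T \<eta> \<le> r"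
      using a fwd_jump_in[OF assms(1)] fwd_jump_ge fwd_jump_le by auto
    have h: "\<bar>gen_monomial T k r (fwd_jump T \<eta>)\<bar> \<le> \<bar>t - c\<bar> ^ k" for k
    proof -
      have "\<bar>gen_monomial T k r (fwd_jump T \<eta>)\<bar> \<le> (r - fwd_jump T \<eta>) ^ k"
        by (rule gen_monomial_bound[OF assms(1) j(1) a(1) j(3) order_refl])
      also have "\<dots> \<le> \<bar>t - c\<bar> ^ k" using a j by (intro power_mono) auto
      finally show ?thesis .
    qed
    have "\<bar>monomial_kernel T n p r \<eta>\<bar> \<le>
        (\<Sum>i = 0..n-1. \<bar>p (n - i) r * gen_monomial T (n - i - 1) r (fwd_jump T \<eta>)\<bar>)"
      unfolding monomial_kernel_def by (rule sum_abs)
    also have "\<dots> \<le> M" unfolding M_def abs_mult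
      using a assms(2) by (intro sum_mono mult_mono P h) auto
    finally show "\<bar>monomial_kernel T n p r \<eta>\<bar> \<le> M" .
  qed
qed

section \<open>Higher derivatives on the truncated time scales\<close>

text \<open>The derivative of order \<open>i + 1\<close> is taken in \<open>kappa_pow T i\<close>. Strictly to the left
  of a point \<open>q\<close> of this set it is well determined and coincides with the derivative in \<open>T\<close>.\<close>

lemma delta_deriv_n_has_derivative:
  assumes "delta_differentiable_n T n y" "i < n" "r \<in> kappa_pow T (Suc i)" "q \<in> kappa_pow T i" "r < q"
  shows "has_delta_derivative T (delta_deriv_n T i y) (delta_deriv_n T (Suc i) y r) r"
proof -
  let ?S = "kappa_pow T i"
  have r: "r \<in> ?S" using assms(3) kappa_subset by (auto simp: kappa_pow_Suc)
  obtain l where l: "has_delta_derivative ?S (delta_deriv_n T i y) l r"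
    using assms(1-3) unfolding delta_differentiable_n_def by blast
  then have "delta_deriv_n T (Suc i) y r = l"
    using has_delta_derivative_unique[OF r assms(4,5)]
    by (auto simp: delta_deriv_def intro!: the_equality)
  moreover have "has_delta_derivative T (delta_deriv_n T i y) l r"
  proof (rule has_delta_derivative_cong_below[OF _ _ assms(5) l])
    show "?S \<inter> {..q} = T \<inter> {..q}"
      using kappa_pow_downward[OF assms(4)] kappa_pow_subset by auto
    show "q \<in> T" using assms(4) kappa_pow_subset by blast
  qed
  ultimately show ?thesis by simp
qed

text \<open>Continuity also holds at \<open>t\<close> itself, where the jumps in \<open>T\<close> and in
  \<open>kappa_pow T i\<close> may differ. This is what lets the integral formulas extend to the endpoint \<open>t\<close>.\<close>

lemma delta_deriv_n_continuous:
  assumes "delta_differentiable_n T n y" "i < n" "t \<in> kappa_pow T n"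
  shows "continuous_on (T \<inter> {..t}) (delta_deriv_n T i y)"
  unfolding continuous_on_eq_continuous_within
proof
  fix r assume r: "r \<in> T \<inter> {..t}"
  have sub: "T \<inter> {..t} \<subseteq> kappa_pow T n" using kappa_pow_downward[OF assms(3)] by auto
  then have "r \<in> kappa_pow T (Suc i)" using r kappa_pow_antimono[of "Suc i" n T] assms(2) by auto
  then obtain l where "has_delta_derivative (kappa_pow T i) (delta_deriv_n T i y) l r"
    using assms(1,2) unfolding delta_differentiable_n_def by blast
  moreover have "T \<inter> {..t} \<subseteq> kappa_pow T i" using sub kappa_pow_antimono[of i n T] assms(2) by auto
  ultimately show "continuous (at r within T \<inter> {..t}) (delta_deriv_n T i y)"
    using r has_delta_derivative_continuous continuous_within_subset by blast
qed

section \<open>The resolvent and the solution of the initial value problem\<close>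

text \<open>With \<open>c = \<sigma>(s)\<close>, the function \<open>\<phi> = y\<^sup>\<Delta>\<^sup>n / lam\<close> solves a Volterra equation on
  \<open>T \<inter> {c..t}\<close>. Taylor's formula expresses the lower derivatives of \<open>y\<close> by monomials and by iterated
  integrals of \<open>lam \<phi>\<close>; inserted into the differential equation, the monomials add up to \<open>K(r,s)\<close> and
  the integrals to \<open>lam\<close> times the integral of \<open>K(r,\<eta>) \<phi>(\<eta>)\<close>. The Neumann series of this equation is the
  resolvent.\<close>

lemma resolvent_sums_after_jump:
  assumes T: "closed T" and n: "n \<ge> 1" and p: "\<forall>i\<in>{1..n}. rd_continuous T (p i)"
    and "lam \<noteq> 0" and t: "t \<in> kappa_pow T n" and s: "s \<in> T"
    and y: "ivp_solution T n p lam s y" and le: "fwd_jump T s \<le> t"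
  shows "(\<lambda>l. iterated_kernel T (monomial_kernel T n p) l t s * lam ^ l) sums (1 / lam * delta_deriv_n T n y t)"
proof -
  define c where "c = fwd_jump T s"
  define v where "v = (\<lambda>i. delta_deriv_n T i y)"
  let ?K = "monomial_kernel T n p"
  have tT: "t \<in> T" using t kappa_pow_subset by blast
  have cT: "c \<in> T" unfolding c_def by (rule fwd_jump_in[OF T s])
  have ct: "c \<le> t" using le by (simp add: c_def)
  have dom: "r \<in> kappa_pow T n" if "r \<in> T" "r \<le> t" for r using kappa_pow_downward[OF t that] .
  have diff: "delta_differentiable_n T n y"
    and ode: "\<And>r. r \<in> kappa_pow T n \<Longrightarrow> v n r = lam * (\<Sum>i = 0..n-1. p (n - i) r * v i r)"
    and init: "\<And>i. i < n \<Longrightarrow> v i c = (if i = n - 1 then 1 else 0)"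
    using y by (auto simp: ivp_solution_def v_def c_def)
  have cont: "continuous_on (T \<inter> {c..t}) (v i)" if "i < n" for i
    using delta_deriv_n_continuous[OF diff that t] unfolding v_def
    by (rule continuous_on_subset) auto
  have der: "has_delta_derivative T (v i) (v (Suc i) r) r" if "i < n" "r \<in> T" "r < t" for i r
    unfolding v_def
  proof (rule delta_deriv_n_has_derivative[OF diff that(1) _ _ that(3)])
    show "r \<in> kappa_pow T (Suc i)" "t \<in> kappa_pow T i"
      using dom[of r] t that kappa_pow_antimono[of "Suc i" n T] kappa_pow_antimono[of i n T] by auto
  qed
  \<comment> \<open>\<open>y\<close> and its derivatives are unknown outside the interval, but integrands must be rd-continuous on
    all of \<open>T\<close>; so the derivatives are continued by constants, while the \<open>p i\<close> are kept\<close>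
  define clamp where "clamp = (\<lambda>r. max c (min r t))"
  define \<phi> where "\<phi> = (\<lambda>r. \<Sum>i = 0..n-1. p (n - i) r * v i (clamp r))"
  have clamp: "clamp r \<in> T \<inter> {c..t}" if "r \<in> T" for r
    using that cT tT ct by (auto simp: clamp_def max_def min_def)
  have clamp_id: "clamp r = r" if "c \<le> r" "r \<le> t" for r using that by (simp add: clamp_def)
  have rd: "rd_continuous T \<phi>"
    unfolding \<phi>_def
  proof (intro rd_continuous_sum rd_continuous_mult)
    fix i assume i: "i \<in> {0..n-1}"
    show "rd_continuous T (p (n - i))" using p i n by auto
    have "continuous_on T clamp" unfolding clamp_def by (intro continuous_intros)
    moreover have "continuous_on (T \<inter> {c..t}) (v i)" using cont i n by auto
    ultimately have "continuous_on T (\<lambda>r. v i (clamp r))"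
      using clamp by (auto intro: continuous_on_compose2)
    then show "rd_continuous T (\<lambda>r. v i (clamp r))" by (rule rd_continuous_if_continuous)
  qed
  have \<phi>: "v n r = lam * \<phi> r" if "r \<in> T" "c \<le> r" "r \<le> t" for r
    using ode[OF dom] that by (simp add: \<phi>_def clamp_id)
  have rd_lam: "rd_continuous T (\<lambda>r. lam * \<phi> r)"
    by (intro rd_continuous_mult rd_continuous_const rd)
  have volterra: "\<phi> r = ?K r s + lam * delta_integral T (\<lambda>\<eta>. ?K r \<eta> * \<phi> \<eta>) c r"
    if r: "r \<in> T" "c \<le> r" "r \<le> t" for r
  proof -
    have taylor: "v i r = gen_monomial T (n - i - 1) r c + iterated_integral T c (n - i) (\<lambda>r. lam * \<phi> r) r"
      if "i \<in> {0..n-1}" for i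
    proof -
      have i: "n - Suc (n - i - 1) = i" "Suc (n - i - 1) = n - i" "n - i - 1 < n" using that n by auto
      have "v (n - Suc (n - i - 1)) r =
          gen_monomial T (n - i - 1) r c + iterated_integral T c (Suc (n - i - 1)) (\<lambda>r. lam * \<phi> r) r"
        by (rule delta_taylor_unit_impulse[OF T cT tT ct rd_lam cont der \<phi> init i(3) r]) auto
      then show ?thesis unfolding i(1) unfolding i(2) .
    qed
    have "\<phi> r = (\<Sum>i = 0..n-1. p (n - i) r * v i r)"
      using r by (simp add: \<phi>_def clamp_id)
    also have "\<dots> = (\<Sum>i = 0..n-1. p (n - i) r *
        (gen_monomial T (n - i - 1) r c + iterated_integral T c (n - i) (\<lambda>r. lam * \<phi> r) r))"
      by (intro sum.cong refl) (simp only: taylor)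
    also have "\<dots> = ?K r s + delta_integral T (\<lambda>\<eta>. ?K r \<eta> * (lam * \<phi> \<eta>)) c r"
      unfolding monomial_kernel_integral[OF T n rd_lam cT r(1)]
      by (simp add: monomial_kernel_def c_def sum.distrib algebra_simps)
    also have "(\<lambda>\<eta>. ?K r \<eta> * (lam * \<phi> \<eta>)) = (\<lambda>\<eta>. lam * (?K r \<eta> * \<phi> \<eta>))"
      by (simp add: mult_ac)
    also have "delta_integral T \<dots> c r = lam * delta_integral T (\<lambda>\<eta>. ?K r \<eta> * \<phi> \<eta>) c r"
      by (rule delta_integral_cmult[OF T rd_continuous_mult[OF
            rd_continuous_monomial_kernel_right[OF T r(1)] rd] cT r(1)])
    finally show ?thesis .
  qed
  obtain M where M: "M \<ge> 0" "\<And>r \<eta>. r \<in> T \<Longrightarrow> \<eta> \<in> T \<Longrightarrow> c \<le> \<eta> \<Longrightarrow> \<eta> < r \<Longrightarrow> r \<le> t \<Longrightarrow> \<bar>?K r \<eta>\<bar> \<le> M"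
    using monomial_kernel_bounded[OF T n p, of c t] by blast
  have "(\<lambda>l. iterated_kernel T ?K l t s * lam ^ l) sums \<phi> t"
  proof (rule neumann_series_sums[OF T cT tT ct rd, where K = ?K and M = M
        and k = "\<lambda>m r. iterated_kernel T ?K m r s"])
    show "\<phi> r = iterated_kernel T ?K 0 r s + lam * delta_integral T (\<lambda>\<eta>. ?K r \<eta> * \<phi> \<eta>) c r"
      if "r \<in> T" "c \<le> r" "r \<le> t" for r
      using volterra[OF that] by simp
  qed (use M rd_continuous_iterated_kernel[OF T n p s] rd_continuous_monomial_kernel_right[OF T]
       in \<open>auto simp: c_def\<close>)
  moreover have "\<phi> t = 1 / lam * v n t" using \<phi>[OF tT ct order_refl] assms(4) by simp
  ultimately show ?thesis by (simp add: v_def)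
qed

text \<open>Here the solution is evaluated at \<open>s\<close>, one gap before its initial point
  \<open>\<sigma>(s)\<close>, so all integrals collapse to multiples of \<open>-\<mu>\<close>. The iterated kernels form a geometric
  progression with sum \<open>\<kappa> / (1 + lam \<mu> \<kappa>)\<close>, where \<open>\<kappa> = K(s,s)\<close>. For \<open>u = y\<^sup>\<Delta>\<^sup>n(s)\<close> the lower
  derivatives at \<open>s\<close> are \<open>(-\<mu>)\<^sup>j (1 - \<mu> u)\<close>, and the differential equation becomes
  \<open>u = lam \<kappa> (1 - \<mu> u)\<close>. Unlike for \<open>t \<ge> \<sigma>(s)\<close>, the series may diverge here, hence the
  summability hypothesis.\<close>

lemma resolvent_sums_before_jump:
  assumes T: "closed T" and n: "n \<ge> 1" and p: "\<forall>i\<in>{1..n}. rd_continuous T (p i)"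
    and "lam \<noteq> 0" and s: "s \<in> kappa_pow T n"
    and y: "ivp_solution T n p lam s y" and less: "s < fwd_jump T s"
    and summable: "summable (\<lambda>l. iterated_kernel T (monomial_kernel T n p) l s s * lam ^ l)"
  shows "(\<lambda>l. iterated_kernel T (monomial_kernel T n p) l s s * lam ^ l) sums (1 / lam * delta_deriv_n T n y s)"
proof -
  define c where "c = fwd_jump T s"
  define \<mu> where "\<mu> = c - s"
  define v where "v = (\<lambda>i. delta_deriv_n T i y)"
  let ?K = "monomial_kernel T n p"
  have sT: "s \<in> T" using s kappa_pow_subset by blast
  have cT: "c \<in> T" unfolding c_def by (rule fwd_jump_in[OF T sT])
  have sk: "s \<in> kappa T" using kappa_if_less[OF sT cT] less by (simp add: c_def)
  have diff: "delta_differentiable_n T n y"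
    and ode: "v n s = lam * (\<Sum>i = 0..n-1. p (n - i) s * v i s)"
    and ck: "c \<in> kappa_pow T (n - 1)"
    and init: "\<And>i. i < n \<Longrightarrow> v i c = (if i = n - 1 then 1 else 0)"
    using y s by (auto simp: ivp_solution_def v_def c_def)
  have jump: "v i s = v i c - \<mu> * v (Suc i) s" if "i < n" for i
  proof -
    have "has_delta_derivative T (v i) (v (Suc i) s) s"
      unfolding v_def
    proof (rule delta_deriv_n_has_derivative[OF diff that])
      have "i \<le> n - 1" using that by simp
      then show "s \<in> kappa_pow T (Suc i)" "c \<in> kappa_pow T i"
        using s ck that kappa_pow_antimono[of "Suc i" n T] kappa_pow_antimono[of i "n - 1" T] by auto
    qed (use less in \<open>simp add: c_def\<close>)
    from has_delta_derivative_scattered[OF this sT] show ?thesis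
      by (simp add: \<mu>_def c_def algebra_simps)
  qed
  define u where "u = v n s"
  have v: "v (n - Suc j) s = (- \<mu>) ^ j * (1 - \<mu> * u)" if "j < n" for j
    using that
  proof (induction j)
    case 0
    then show ?case using jump[of "n - 1"] init[of "n - 1"] by (simp add: u_def)
  next
    case (Suc j)
    then have "n - Suc (Suc j) < n" "Suc (n - Suc (Suc j)) = n - Suc j" "n - Suc (Suc j) \<noteq> n - 1" by auto
    then show ?case using jump[of "n - Suc (Suc j)"] init[of "n - Suc (Suc j)"] Suc by simp
  qed
  have h: "gen_monomial T j s c = (- \<mu>) ^ j" for j
  proof (induction j)
    case (Suc j)
    then show ?case
      using delta_integral_jump[OF T rd_continuous_gen_monomial[OF T] sk, of j c]
      by (simp add: \<mu>_def c_def)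
  qed simp
  define \<kappa> where "\<kappa> = ?K s s"
  have k: "iterated_kernel T ?K m s s = \<kappa> * (- (\<mu> * \<kappa>)) ^ m" for m
  proof (induction m)
    case (Suc m)
    have "rd_continuous T (\<lambda>\<eta>. ?K s \<eta> * iterated_kernel T ?K m \<eta> s)"
      by (intro rd_continuous_mult rd_continuous_monomial_kernel_right
          rd_continuous_iterated_kernel T n p sT)
    from delta_integral_jump[OF T this sk] Suc show ?case
      by (simp add: \<mu>_def c_def \<kappa>_def algebra_simps)
  qed (simp add: \<kappa>_def)
  define x where "x = - (\<mu> * \<kappa> * lam)"
  have terms: "(\<lambda>l. iterated_kernel T ?K l s s * lam ^ l) = (\<lambda>l. \<kappa> * x ^ l)"
    by (simp add: k x_def mult.assoc power_mult_distrib[symmetric])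
  have "(\<Sum>i = 0..n-1. p (n - i) s * v i s) = (\<Sum>i = 0..n-1. p (n - i) s * gen_monomial T (n - i - 1) s c * (1 - \<mu> * u))"
  proof (rule sum.cong[OF refl])
    fix i assume "i \<in> {0..n-1}"
    then have "n - Suc (n - i - 1) = i" "n - i - 1 < n" using n by auto
    then show "p (n - i) s * v i s = p (n - i) s * gen_monomial T (n - i - 1) s c * (1 - \<mu> * u)"
      using v[of "n - i - 1"] h by simp
  qed
  also have "\<dots> = \<kappa> * (1 - \<mu> * u)"
    by (simp add: \<kappa>_def monomial_kernel_def c_def sum_distrib_right)
  finally have u: "u * (1 - x) = lam * \<kappa>"
    using ode by (simp add: u_def x_def algebra_simps)
  have "(\<lambda>l. \<kappa> * x ^ l) sums (1 / lam * u)"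
  proof (cases "\<kappa> = 0")
    case True
    then show ?thesis using u by (simp add: x_def)
  next
    case False
    then have "summable (\<lambda>l. x ^ l)" using summable unfolding terms by (simp add: summable_cmult_iff)
    then have x: "norm x < 1" by (simp only: summable_geometric_iff)
    then have "(\<lambda>l. \<kappa> * x ^ l) sums (\<kappa> * (1 / (1 - x)))" by (intro sums_mult geometric_sums)
    moreover have "1 - x \<noteq> 0" using x by auto
    then have "\<kappa> * (1 / (1 - x)) = 1 / lam * u" using u assms(4) by (simp add: field_simps)
    ultimately show ?thesis by simp
  qed
  then show ?thesis unfolding terms by (simp add: u_def v_def)
qed

theorem lemma5:
  fixes T :: "real set" and a b lam s t :: real and n :: nat
    and p :: "nat \<Rightarrow> real \<Rightarrow> real" and K :: "real \<Rightarrow> real \<Rightarrow> real" and y :: "real \<Rightarrow> real"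
  assumes "time_scale T"
    and "a \<in> T" and "b \<in> T" and "a < b"
    and "n \<ge> 1"
    and "\<forall>i\<in>{1..n}. rd_continuous T (p i)"
    and "K = (\<lambda>t s. \<Sum>i = 0..n-1. p (n - i) t * gen_monomial T (n - i - 1) t (fwd_jump T s))"
    and "lam \<noteq> 0"
    and "t \<in> kappa_pow T n" and "s \<in> kappa_pow T (n - 1)" and "(t, s) \<in> Omega T a b"
    and "ivp_solution T n p lam s y"
    and "t < fwd_jump T s \<Longrightarrow> summable (\<lambda>l. iterated_kernel T K l t s * lam ^ l)"
  shows "summable (\<lambda>l. iterated_kernel T K l t s * lam ^ l) \<and>
         resolvent_kernel T K lam t s = 1 / lam * delta_deriv_n T n y t"
proof -
  have T: "closed T" using assms(1) by (simp add: time_scale_def)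
  have K: "K = monomial_kernel T n p" using assms(7) by (simp add: monomial_kernel_def)
  have ts: "t \<in> T" "s \<in> T" "s \<le> t" using assms(11) by (auto simp: Omega_def)
  have "(\<lambda>l. iterated_kernel T K l t s * lam ^ l) sums (1 / lam * delta_deriv_n T n y t)"
  proof (cases "fwd_jump T s \<le> t")
    case True
    then show ?thesis
      unfolding K by (intro resolvent_sums_after_jump T assms ts)
  next
    case False
    then have less: "t < fwd_jump T s" by simp
    \<comment> \<open>a point of \<open>T\<close> beyond \<open>s\<close> would not lie before the jump of \<open>s\<close>\<close>
    have "\<not> s < t" using fwd_jump_le[OF ts(1), of s] less by auto
    then have "t = s" using ts(3) by simp
    show ?thesis unfolding K \<open>t = s\<close>
      using resolvent_sums_before_jump[OF T assms(5,6,8) _ assms(12)] assms(9) assms(13)[OF less] less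
      unfolding K \<open>t = s\<close> by blast
  qed
  then show ?thesis by (auto simp: resolvent_kernel_def sums_iff)
qed

end
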